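(* Let $|||\cdot|||$ be any unitarily invariant norm on the space of $n\times n$ complex matrices. Let $W$ be an $n\times n$ complex unitary matrix such that $-1$ is not an eigenvalue of $W'W$ (where $W'$ is the transpose of $W$), and let $W=W_1W_2$ be its unique factorization with $W_1$ real orthogonal and $W_2$ a symmetric unitary matrix all of whose eigenvalues lie in the open right half plane. Let $\sigma(W_2)=\{e^{i\theta_1},\ldots,e^{i\theta_n}\}$. Let $\{a_m\}_{m\in\mathbb Z}$ be any $\ell_1$-sequence such that for all $\theta=\theta_i-\theta_j$ $(1\leq i,j\leq n)$ $$\sum_{m=-\infty}^{\infty}(-1)^m a_m e^{im\theta}=\frac{1}{1+e^{i\theta}}.$$ Then for $k=1,2$ $$|||\mathrm{D}\Phi_k(W)|||\leq 2\left(\sum_{m=-\infty}^{\infty}|a_m|\right),$$ where $\Phi_k(W)=W_k$.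
   Context: Let $\mathbb U=\{W\in\mathbb U(n,\mathbb C): -1\notin\sigma(W'W)\}$, where $\mathbb U(n,\mathbb C)$ is the group of $n\times n$ complex unitary matrices, $W'$ is the transpose and $\sigma$ denotes the spectrum. Let $\mathbb O(n,\mathbb R)$ be the real orthogonal matrices and $\mathbb U_{\mathrm{sym}^+}$ the set of unitary $U$ with $U'=U$ and all eigenvalues in the open right half plane. Every $W\in\mathbb U$ factors uniquely as $W=W_1W_2$ with $W_1\in\mathbb O(n,\mathbb R)$, $W_2\in\mathbb U_{\mathrm{sym}^+}$. Define $\Phi:\mathbb U\to\mathbb O(n,\mathbb R)\times\mathbb U_{\mathrm{sym}^+}$ by $\Phi(W)=(\Phi_1(W),\Phi_2(W))=(W_1,W_2)$. The derivative $\mathrm{D}\Phi_k(W)$ is the real-linear map defined on the tangent space $\{WS: S \text{ an } n\times n\text{ complex skew-Hermitian matrix}\}$ to $\mathbb U$ at $W$, with values in $n\times n$ complex matrices, and $|||\mathrm{D}\Phi_k(W)|||=\sup\{|||\mathrm{D}\Phi_k(W)(WS)|||: S\text{ skew-Hermitian},\ |||WS|||=1\}$. A norm is unitarily invariant if $|||UAV|||=|||A|||$ for all matrices $A$ and all unitary $U,V$. *)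

theory Defs
  imports "HOL-Analysis.Analysis"
begin

definition conj_transpose :: "complex^'n^'n \<Rightarrow> complex^'n^'n"
  where "conj_transpose A = map_matrix cnj (transpose A)"

definition unitary_matrix :: "complex^'n^'n \<Rightarrow> bool"
  where "unitary_matrix U \<longleftrightarrow>
    conj_transpose U ** U = mat 1 \<and> U ** conj_transpose U = mat 1"

definition skew_hermitian :: "complex^'n^'n \<Rightarrow> bool"
  where "skew_hermitian S \<longleftrightarrow> conj_transpose S = - S"

definition spectrum :: "complex^'n^'n \<Rightarrow> complex set"
  where "spectrum A = {\<mu>. \<exists>v. v \<noteq> 0 \<and> A *v v = \<mu> *s v}"

text \<open>The set on which the factorization is defined; \<^const>\<open>transpose\<close> is the
  transpose without complex conjugation.\<close>

definition UU :: "(complex^'n^'n) set"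
  where "UU = {W. unitary_matrix W \<and> - 1 \<notin> spectrum (transpose W ** W)}"

text \<open>The real orthogonal matrices, regarded as complex matrices.\<close>

definition real_orthogonal :: "(complex^'n^'n) set"
  where "real_orthogonal =
    {map_matrix complex_of_real Q | Q :: real^'n^'n. orthogonal_matrix Q}"

definition Usym_plus :: "(complex^'n^'n) set"
  where "Usym_plus =
    {U. unitary_matrix U \<and> transpose U = U \<and> (\<forall>\<mu>\<in>spectrum U. Re \<mu> > 0)}"

text \<open>Only the values of \<open>Phi\<close> on \<^const>\<open>UU\<close> are meaningful: there the factorization
  exists and is unique.\<close>

definition Phi :: "complex^'n^'n \<Rightarrow> (complex^'n^'n) \<times> (complex^'n^'n)"
  where "Phi W =
    (THE P. P \<in> real_orthogonal \<times> Usym_plus \<and> W = fst P ** snd P)"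

definition Phi1 :: "complex^'n^'n \<Rightarrow> complex^'n^'n"
  where "Phi1 W = fst (Phi W)"

definition Phi2 :: "complex^'n^'n \<Rightarrow> complex^'n^'n"
  where "Phi2 W = snd (Phi W)"

definition matrix_norm :: "(complex^'n^'n \<Rightarrow> real) \<Rightarrow> bool"
  where "matrix_norm N \<longleftrightarrow>
    (\<forall>A. 0 \<le> N A) \<and>
    (\<forall>A. N A = 0 \<longleftrightarrow> A = 0) \<and>
    (\<forall>c A. N (map_matrix ((*) c) A) = cmod c * N A) \<and>
    (\<forall>A B. N (A + B) \<le> N A + N B)"

definition unitarily_invariant_norm :: "(complex^'n^'n \<Rightarrow> real) \<Rightarrow> bool"
  where "unitarily_invariant_norm N \<longleftrightarrow> matrix_norm N \<and>
    (\<forall>A U V. unitary_matrix U \<longrightarrow> unitary_matrix V \<longrightarrow> N (U ** A ** V) = N A)"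

text \<open>The norm of a linear map \<open>D\<close> on the tangent space \<open>{W ** S | S. skew_hermitian S}\<close>
  to \<^const>\<open>UU\<close> at \<open>W\<close>.  The supremum is taken in \<^typ>\<open>ereal\<close>, so that no boundedness
  is presupposed.  A derivative of a function at \<open>W\<close> within \<^const>\<open>UU\<close> is a linear map on
  the whole matrix space which is determined only on the tangent space, and only
  its values there enter.\<close>

definition tangent_norm ::
    "(complex^'n^'n \<Rightarrow> real) \<Rightarrow> complex^'n^'n \<Rightarrow> (complex^'n^'n \<Rightarrow> complex^'n^'n) \<Rightarrow> ereal"
  where "tangent_norm N W D =
    (SUP S\<in>{S. skew_hermitian S \<and> N (W ** S) = 1}. ereal (N (D (W ** S))))"

end

theory Submission
  imports Defs "HOL-Computational_Algebra.Fundamental_Theorem_Algebra"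
begin

text \<open>The identities \<open>\<Phi>\<^sub>1(W) \<Phi>\<^sub>2(W) = W\<close> and \<open>\<Phi>\<^sub>2(W)\<^sup>2 = W'W\<close>, differentiated in a tangent
  direction \<open>WS\<close>, are Sylvester equations for the two derivatives with coefficient \<open>W\<^sub>2\<close>. In an
  eigenbasis of \<open>W\<^sub>2\<close> they are solved entrywise: both derivatives are combinations of \<open>S\<close> and \<open>S'\<close>
  multiplied entrywise by \<open>1 / (1 + cis (\<theta>\<^sub>j - \<theta>\<^sub>i))\<close> and \<open>1 / (1 + cis (\<theta>\<^sub>i - \<theta>\<^sub>j))\<close>. Expanding the
  multiplier in the given series writes such a product as a sum of terms
  \<open>\<plusminus> a\<^sub>m U\<^sup>m Y U\<^sup>-\<^sup>m\<close> with \<open>U\<close> unitary, so its norm is at most \<open>\<Sum> \<bar>a\<^sub>m\<bar>\<close> times that of \<open>Y\<close>;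
  moreover \<open>S\<close> and \<open>S'\<close> have the same norm since \<open>S\<close> is unitarily diagonalizable.

  Differentiability rests on the accretivity of the elements of \<^const>\<open>Usym_plus\<close>: it makes the
  Sylvester operator \<open>Z \<mapsto> X Z + Z X\<close> bounded below, hence the square root Lipschitz, and
  the remainder in its linearization is quadratic.\<close>

section \<open>Unitary diagonalization of normal matrices\<close>

lemma conj_transpose_nth [simp]: "conj_transpose A $ i $ j = cnj (A $ j $ i)"
  by (simp add: conj_transpose_def map_matrix_def transpose_def)

lemma transpose_nth [simp]: "transpose A $ i $ j = A $ j $ i"
  by (simp add: transpose_def)

lemma matrix_matrix_mult_nth: "(A ** B) $ i $ j = (\<Sum>k\<in>UNIV. A $ i $ k * B $ k $ j)"
  by (simp add: matrix_matrix_mult_def)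

lemma conj_transpose_involution [simp]: "conj_transpose (conj_transpose A) = A"
  by (simp add: vec_eq_iff)

lemma conj_transpose_mult: "conj_transpose (A ** B) = conj_transpose B ** conj_transpose A"
  by (simp add: vec_eq_iff matrix_matrix_mult_nth mult.commute)

lemma transpose_conj_transpose:
  "transpose (conj_transpose A) = conj_transpose (transpose A)"
  by (simp add: vec_eq_iff)

definition cinner :: "complex^'n \<Rightarrow> complex^'n \<Rightarrow> complex"
  where "cinner x y = (\<Sum>i\<in>UNIV. cnj (x $ i) * y $ i)"

lemma cinner_simps:
  "cinner x (y + z) = cinner x y + cinner x z"
  "cinner (y + z) x = cinner y x + cinner z x"
  "cinner x (y - z) = cinner x y - cinner x z"
  "cinner (y - z) x = cinner y x - cinner z x"
  "cinner x (c *s y) = c * cinner x y"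
  "cinner (c *s x) y = cnj c * cinner x y"
  by (simp_all add: cinner_def algebra_simps sum.distrib sum_subtractf sum_distrib_left)

lemma cinner_cnj: "cnj (cinner x y) = cinner y x"
  by (simp add: cinner_def mult.commute)

lemma cinner_self: "cinner x x = of_real ((norm x)\<^sup>2)"
proof -
  have "(norm x)\<^sup>2 = (\<Sum>i\<in>UNIV. (cmod (x $ i))\<^sup>2)"
    by (simp add: norm_vec_def L2_set_def sum_nonneg)
  then show ?thesis
    by (simp add: cinner_def complex_norm_square[symmetric] mult.commute)
qed

lemma cinner_eq_0_iff [simp]: "cinner x x = 0 \<longleftrightarrow> x = 0"
  by (simp add: cinner_self)

lemma cinner_adjoint: "cinner x (A *v y) = cinner (conj_transpose A *v x) y"
proof -
  have "cinner x (A *v y) = (\<Sum>i\<in>UNIV. \<Sum>j\<in>UNIV. cnj (x $ i) * (A $ i $ j * y $ j))"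
    by (simp add: cinner_def matrix_vector_mult_def sum_distrib_left)
  also have "\<dots> = (\<Sum>j\<in>UNIV. \<Sum>i\<in>UNIV. cnj (x $ i) * (A $ i $ j * y $ j))"
    by (rule sum.swap)
  also have "\<dots> = cinner (conj_transpose A *v x) y"
    by (simp add: cinner_def matrix_vector_mult_def sum_distrib_right sum_distrib_left mult_ac)
  finally show ?thesis .
qed

definition normal_matrix :: "complex^'n^'n \<Rightarrow> bool"
  where "normal_matrix A \<longleftrightarrow> A ** conj_transpose A = conj_transpose A ** A"

text \<open>Normality gives \<open>A *v v\<close> and \<open>conj_transpose A *v v\<close> the same
  length. Hence all four terms in the expansion of the squared length of the difference of the two
  sides equal the squared modulus of \<open>\<mu>\<close> times \<open>cinner v v\<close>, and they
  cancel.\<close>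

lemma normal_matrix_eigenvector_adjoint:
  assumes "normal_matrix A" and v: "A *v v = \<mu> *s v"
  shows "conj_transpose A *v v = cnj \<mu> *s v"
proof -
  let ?B = "conj_transpose A"
  have eq: "cinner (?B *v v) (?B *v v) = cinner (A *v v) (A *v v)"
    using assms(1) cinner_adjoint[of v A "?B *v v"] cinner_adjoint[of v "?B" "A *v v"]
    by (simp add: normal_matrix_def matrix_vector_mul_assoc)
  have "cinner (?B *v v) v = \<mu> * cinner v v"
    using cinner_adjoint[of v A v] by (simp add: v cinner_simps)
  moreover from this have "cinner v (?B *v v) = cnj \<mu> * cinner v v"
    by (metis cinner_cnj complex_cnj_mult)
  ultimately have "cinner (?B *v v - cnj \<mu> *s v) (?B *v v - cnj \<mu> *s v) = 0"
    using eq by (simp add: v cinner_simps algebra_simps)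
  then show ?thesis by simp
qed

section \<open>Eigenvectors inside invariant subspaces\<close>

definition poly_apply :: "complex poly \<Rightarrow> complex^'n^'n \<Rightarrow> complex^'n \<Rightarrow> complex^'n"
  where "poly_apply p A x = (\<Sum>i\<le>degree p. coeff p i *s (((*v) A) ^^ i) x)"

lemma poly_apply_bound:
  assumes "degree p \<le> K"
  shows "poly_apply p A x = (\<Sum>i\<le>K. coeff p i *s (((*v) A) ^^ i) x)"
  unfolding poly_apply_def
  by (rule sum.mono_neutral_left) (use assms in \<open>auto simp: coeff_eq_0\<close>)

lemma funpow_matrix_linear:
  "(((*v) A) ^^ i) (x - c *s y) = (((*v) A) ^^ i) x - c *s (((*v) A) ^^ i) y"
  for A :: "complex^'n^'n"
  by (induction i) (simp_all add: matrix_vector_mult_diff_distrib vector_scalar_commute)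

text \<open>Used to peel a root off an annihilating polynomial: the linear factor moves from the
  polynomial onto the vector. The coefficients of the product are the shifted coefficients of
  \<open>q\<close> minus \<open>\<mu>\<close> times those of \<open>q\<close>, and the shift is
  absorbed as one application of \<open>A\<close>.\<close>

lemma poly_apply_linear_factor:
  "poly_apply ([:- \<mu>, 1:] * q) A x = poly_apply q A (A *v x - \<mu> *s x)"
proof -
  let ?P = "\<lambda>i. ((*v) A) ^^ i"
  define K where "K = degree q"
  have co: "coeff ([:- \<mu>, 1:] * q) i = (case i of 0 \<Rightarrow> 0 | Suc j \<Rightarrow> coeff q j) - \<mu> * coeff q i" for i
    by (simp add: coeff_pCons split: nat.split)
  have "degree ([:- \<mu>, 1:] * q) \<le> Suc K"
    using degree_mult_le[of "[:- \<mu>, 1:]" q] by (simp add: K_def)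
  then have "poly_apply ([:- \<mu>, 1:] * q) A x = (\<Sum>i\<le>Suc K. coeff ([:- \<mu>, 1:] * q) i *s ?P i x)"
    by (rule poly_apply_bound)
  also have "\<dots> = (\<Sum>i\<le>Suc K. (case i of 0 \<Rightarrow> 0 | Suc j \<Rightarrow> coeff q j) *s ?P i x)
      - (\<Sum>i\<le>Suc K. (\<mu> * coeff q i) *s ?P i x)"
    unfolding co by (simp only: vector_sub_rdistrib sum_subtractf)
  also have "(\<Sum>i\<le>Suc K. (case i of 0 \<Rightarrow> 0 | Suc j \<Rightarrow> coeff q j) *s ?P i x)
      = (\<Sum>i\<le>K. coeff q i *s ?P i (A *v x))"
    by (subst sum.atMost_Suc_shift) (simp add: funpow_swap1)
  also have "(\<Sum>i\<le>Suc K. (\<mu> * coeff q i) *s ?P i x) = (\<Sum>i\<le>K. coeff q i *s (\<mu> *s ?P i x))"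
    by (simp add: K_def coeff_eq_0 vector_smult_assoc mult.commute)
  finally show ?thesis
    by (simp add: poly_apply_def K_def funpow_matrix_linear vector_ssub_ldistrib sum_subtractf)
qed

text \<open>The iterates of \<open>x\<close> under \<open>A\<close> from exponent 0 to
  \<open>K\<close> are one more than the real dimension \<open>K\<close> of the space, hence
  linearly dependent. A real dependence is enough, since its coefficients can be read as complex
  ones.\<close>

lemma poly_apply_annihilator:
  "\<exists>p. p \<noteq> 0 \<and> poly_apply p A x = 0" for A :: "complex^'n^'n"
proof -
  let ?P = "\<lambda>i. (((*v) A) ^^ i) x"
  define K where "K = DIM(complex^'n)"
  have "\<exists>u :: nat \<Rightarrow> complex. (\<exists>i\<le>K. u i \<noteq> 0) \<and> (\<Sum>i\<le>K. u i *s ?P i) = 0"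
  proof (cases "inj_on ?P {..K}")
    case True
    then have "card (?P ` {..K}) = Suc K" by (simp add: card_image)
    then have "dependent (?P ` {..K})"
      by (intro dependent_biggerset) (simp_all add: K_def)
    then obtain u where u: "(\<Sum>v\<in>?P ` {..K}. u v *\<^sub>R v) = 0" "\<exists>v\<in>?P ` {..K}. u v \<noteq> 0"
      by (auto simp: real_vector.dependent_finite)
    have "(\<Sum>i\<le>K. complex_of_real (u (?P i)) *s ?P i) = (\<Sum>i\<le>K. u (?P i) *\<^sub>R ?P i)"
      by (rule sum.cong) (simp_all add: vec_eq_iff scaleR_conv_of_real[where 'a = complex])
    also have "\<dots> = 0"
      using u(1) by (simp add: sum.reindex[OF True])
    finally show ?thesis using u(2)
      by (intro exI[of _ "\<lambda>i. complex_of_real (u (?P i))"]) auto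
  next
    \<comment> \<open>If two iterates coincide, the set of iterates is too small for the dimension
      count; the coefficients 1 and -1 at the coinciding exponents then give the relation.\<close>
    case False
    then obtain i j where ij: "i \<le> K" "j \<le> K" "i \<noteq> j" "?P i = ?P j"
      by (auto simp: inj_on_def)
    let ?u = "\<lambda>k. if k = i then 1 else if k = j then - 1 else (0::complex)"
    have "(\<Sum>k\<le>K. ?u k *s ?P k) = (\<Sum>k\<in>{i, j}. ?u k *s ?P k)"
      by (rule sum.mono_neutral_right) (use ij in auto)
    also have "\<dots> = 0" using ij by simp
    finally show ?thesis using ij(1) by (intro exI[of _ ?u]) auto
  qed
  then obtain u :: "nat \<Rightarrow> complex" and j
    where u: "j \<le> K" "u j \<noteq> 0" "(\<Sum>i\<le>K. u i *s ?P i) = 0" by blast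
  define p where "p = (\<Sum>i\<le>K. monom (u i) i)"
  have co: "coeff p i = (if i \<le> K then u i else 0)" for i
    by (simp add: p_def coeff_sum)
  have "p \<noteq> 0" using co[of j] u by auto
  moreover have "degree p \<le> K" by (rule degree_le) (simp add: co)
  ultimately show ?thesis
    using u(3) by (intro exI[of _ p]) (simp add: poly_apply_bound co)
qed

text \<open>Induction on the degree of a polynomial annihilating \<open>x\<close>. For a root
  \<open>\<mu>\<close>, either \<open>A *v x - \<mu> *s x\<close> vanishes and \<open>x\<close> is
  an eigenvector, or it is a nonzero vector of \<open>M\<close> annihilated by the cofactor, whose
  degree is smaller.\<close>

lemma invariant_subspace_eigenvector:
  fixes A :: "complex^'n^'n"
  assumes x: "x \<in> M" "x \<noteq> 0"
    and inv: "\<And>y. y \<in> M \<Longrightarrow> A *v y \<in> M"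
    and sub: "\<And>y z c. y \<in> M \<Longrightarrow> z \<in> M \<Longrightarrow> y - c *s z \<in> M"
  shows "\<exists>v \<mu>. v \<in> M \<and> v \<noteq> 0 \<and> A *v v = \<mu> *s v"
proof -
  obtain p where "p \<noteq> 0" "poly_apply p A x = 0" using poly_apply_annihilator by blast
  then show ?thesis using x
  proof (induction "degree p" arbitrary: p x rule: less_induct)
    case less
    have "\<not> constant (poly p)"
    proof
      assume "constant (poly p)"
      then have "degree p = 0" by (simp add: constant_degree)
      then have "coeff p 0 \<noteq> 0" using less.prems(1) by (auto elim: degree_eq_zeroE)
      then show False
        using less.prems \<open>degree p = 0\<close> by (simp add: poly_apply_def vec_eq_iff)
    qed
    then obtain \<mu> where "poly p \<mu> = 0" using fundamental_theorem_of_algebra by blast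
    then obtain q where q: "p = [:- \<mu>, 1:] * q" by (auto simp: poly_eq_0_iff_dvd)
    with less.prems(1) have "q \<noteq> 0" by auto
    then have deg: "degree q < degree p" unfolding q by (subst degree_mult_eq) auto
    show ?case
    proof (cases "A *v x - \<mu> *s x = 0")
      case True
      with less.prems show ?thesis by auto
    next
      case False
      have "poly_apply q A (A *v x - \<mu> *s x) = 0"
        using less.prems(2) unfolding q poly_apply_linear_factor .
      from less.hyps[OF deg \<open>q \<noteq> 0\<close> this _ False] show ?thesis
        using less.prems(3) inv sub by blast
    qed
  qed
qed

text \<open>The linear map \<open>f\<close> collects the inner products with the vectors
  \<open>v i\<close>. Its coordinate \<open>j\<close> is always 0, so it is not surjective, and an
  endomorphism of a finite-dimensional space that is not surjective has a nonzero kernel.\<close>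

lemma ex_orthogonal_vector:
  fixes v :: "'n \<Rightarrow> complex^'n"
  assumes "j \<notin> J"
  shows "\<exists>x. x \<noteq> 0 \<and> (\<forall>i\<in>J. cinner (v i) x = 0)"
proof -
  define f where "f x = (\<chi> i. if i \<in> J then cinner (v i) x else 0)" for x
  have lin: "linear f"
    by (rule linearI) (auto simp: f_def vec_eq_iff cinner_def sum.distrib algebra_simps scaleR_sum_right)
  have "\<not> surj f"
  proof
    assume "surj f"
    then obtain x where "f x = axis j 1" by (metis surjD)
    then have "f x $ j = 1" by simp
    with assms show False by (simp add: f_def)
  qed
  then have "\<not> inj f" using lin linear_injective_imp_surjective by blast
  then obtain x where "x \<noteq> 0" "f x = 0" using linear_injective_0[OF lin] by blast
  then show ?thesis
    by (intro exI[of _ x]) (auto simp: f_def vec_eq_iff split: if_splits)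
qed

text \<open>The eigenvectors found so far are also eigenvectors of the adjoint, so their orthogonal
  complement \<open>M\<close> is invariant under \<open>A\<close> and contains a further
  eigenvector. Indexing by subsets of \<open>'n\<close> makes the family for \<open>UNIV\<close>
  directly usable as matrix columns.\<close>

lemma normal_matrix_orthonormal_eigenvectors:
  fixes A :: "complex^'n^'n" and J :: "'n set"
  assumes A: "normal_matrix A" and "finite J"
  shows "\<exists>v d. (\<forall>i\<in>J. A *v v i = d i *s v i) \<and>
    (\<forall>i\<in>J. \<forall>k\<in>J. cinner (v i) (v k) = (if i = k then 1 else 0))"
  using \<open>finite J\<close>
proof (induction J)
  case empty
  then show ?case by auto
next
  case (insert j J)
  then obtain v d where v: "\<And>i. i \<in> J \<Longrightarrow> A *v v i = d i *s v i"
    and on: "\<And>i k. i \<in> J \<Longrightarrow> k \<in> J \<Longrightarrow> cinner (v i) (v k) = (if i = k then 1 else 0)"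
    by blast
  define M where "M = {x. \<forall>i\<in>J. cinner (v i) x = 0}"
  obtain x where x: "x \<in> M" "x \<noteq> 0"
    using ex_orthogonal_vector[OF insert.hyps(2), of v] by (auto simp: M_def)
  have inv: "A *v y \<in> M" if "y \<in> M" for y
    using that normal_matrix_eigenvector_adjoint[OF A v]
    by (auto simp: M_def cinner_adjoint cinner_simps)
  have sub: "y - c *s z \<in> M" if "y \<in> M" "z \<in> M" for y z c
    using that by (simp add: M_def cinner_simps)
  obtain w \<mu> where w: "w \<in> M" "w \<noteq> 0" "A *v w = \<mu> *s w"
    using invariant_subspace_eigenvector[OF x inv sub] by blast
  define u where "u = complex_of_real (1 / norm w) *s w"
  have u: "A *v u = \<mu> *s u"
    by (simp add: u_def vector_scalar_commute w vector_smult_assoc mult.commute)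
  have uu: "cinner u u = 1"
    using w(2) by (simp only: u_def cinner_simps) (simp add: cinner_self power2_eq_square)
  have vu: "cinner (v i) u = 0" if "i \<in> J" for i
    using w(1) that by (simp add: u_def M_def cinner_simps)
  then have uv: "cinner u (v i) = 0" if "i \<in> J" for i
    using that cinner_cnj[of "v i" u] by simp
  show ?case
    by (intro exI[of _ "v(j := u)"] exI[of _ "d(j := \<mu>)"])
      (use insert.hyps v on u uu vu uv in auto)
qed

section \<open>Diagonal matrices, the spectral theorem and unitary matrices\<close>

definition diag :: "('n \<Rightarrow> complex) \<Rightarrow> complex^'n^'n"
  where "diag d = (\<chi> i j. if i = j then d i else 0)"

lemma diag_nth: "diag d $ i $ j = (if i = j then d i else 0)"
  by (simp add: diag_def)

lemma diag_mult_nth [simp]: "(diag d ** A) $ i $ j = d i * A $ i $ j"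
proof -
  have "(diag d ** A) $ i $ j = (\<Sum>k\<in>UNIV. if i = k then d i * A $ k $ j else 0)"
    unfolding matrix_matrix_mult_nth by (rule sum.cong) (auto simp: diag_nth)
  then show ?thesis by simp
qed

lemma mult_diag_nth [simp]: "(A ** diag d) $ i $ j = A $ i $ j * d j"
proof -
  have "(A ** diag d) $ i $ j = (\<Sum>k\<in>UNIV. if k = j then A $ i $ k * d k else 0)"
    unfolding matrix_matrix_mult_nth by (rule sum.cong) (auto simp: diag_nth)
  then show ?thesis by simp
qed

lemma diag_mult_diag: "diag d ** diag e = diag (\<lambda>i. d i * e i)"
  by (simp add: vec_eq_iff diag_nth)

lemma conj_transpose_diag: "conj_transpose (diag d) = diag (\<lambda>i. cnj (d i))"
  by (auto simp: vec_eq_iff diag_nth)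

lemma transpose_diag: "transpose (diag d) = diag d"
  by (auto simp: vec_eq_iff diag_nth)

lemma unitary_matrix_iff_left: "unitary_matrix U \<longleftrightarrow> conj_transpose U ** U = mat 1"
  unfolding unitary_matrix_def using matrix_left_right_inverse[of U "conj_transpose U"] by blast

theorem normal_matrix_diagonalization:
  fixes A :: "complex^'n^'n"
  assumes "normal_matrix A"
  obtains V d where "unitary_matrix V" and "A = V ** diag d ** conj_transpose V"
proof -
  obtain v :: "'n \<Rightarrow> complex^'n" and d
    where v: "\<And>i. A *v v i = d i *s v i"
    and on: "\<And>i k. cinner (v i) (v k) = (if i = k then 1 else 0)"
    using normal_matrix_orthonormal_eigenvectors[OF assms finite[of UNIV]] by auto
  define V where "V = (\<chi> i j. v j $ i)"
  have "conj_transpose V ** V = mat 1"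
    using on by (simp add: vec_eq_iff matrix_matrix_mult_nth V_def mat_def cinner_def)
  then have V: "unitary_matrix V" by (simp add: unitary_matrix_iff_left)
  have "(A ** V) $ i $ j = (V ** diag d) $ i $ j" for i j
    using arg_cong[OF v[of j], of "\<lambda>x. x $ i"]
    by (simp add: matrix_matrix_mult_nth[where A = A] V_def matrix_vector_mult_def mult.commute)
  then have "A ** V = V ** diag d" by (simp only: vec_eq_iff) simp
  then have "A = V ** diag d ** conj_transpose V"
    using V[unfolded unitary_matrix_def]
      matrix_mul_assoc[of A V "conj_transpose V"] by simp
  with V show ?thesis by (rule that)
qed

lemma unitary_matrix_cancel:
  assumes "unitary_matrix U"
  shows "conj_transpose U ** U = mat 1" "U ** conj_transpose U = mat 1"
    "conj_transpose U ** (U ** A) = A" "U ** (conj_transpose U ** A) = A"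
  using assms by (simp_all add: unitary_matrix_def matrix_mul_assoc)

lemma unitary_matrix_conj_transpose: "unitary_matrix U \<Longrightarrow> unitary_matrix (conj_transpose U)"
  by (simp add: unitary_matrix_def)

lemma unitary_matrix_transpose:
  assumes "unitary_matrix U"
  shows "unitary_matrix (transpose U)"
proof -
  have "transpose (U ** conj_transpose U) = mat 1"
    using assms by (simp add: unitary_matrix_def)
  then show ?thesis
    by (simp add: unitary_matrix_iff_left matrix_transpose_mul transpose_conj_transpose)
qed

lemma unitary_matrix_mult:
  assumes "unitary_matrix U" "unitary_matrix V"
  shows "unitary_matrix (U ** V)"
  using assms
  by (simp add: unitary_matrix_iff_left conj_transpose_mult matrix_mul_assoc[symmetric]
      unitary_matrix_cancel)

lemma unitary_matrix_diag: "unitary_matrix (diag d) \<longleftrightarrow> (\<forall>i. cmod (d i) = 1)"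
proof -
  have "cnj z * z = 1 \<longleftrightarrow> cmod z = 1" for z
    using complex_norm_square[of z]
    by (metis mult.commute norm_eq_1 norm_ge_zero of_real_1 of_real_eq_iff power2_eq_1_iff
        power2_eq_square one_power2 power2_eq_imp_eq zero_le_one)
  then show ?thesis
    by (auto simp: unitary_matrix_iff_left conj_transpose_diag diag_mult_diag vec_eq_iff
        diag_nth mat_def)
qed

lemma normal_matrix_unitary: "unitary_matrix U \<Longrightarrow> normal_matrix U"
  by (simp add: unitary_matrix_def normal_matrix_def)

lemma matrix_minus_mult: "(- A) ** B = - (A ** B)" "B ** (- A) = - (B ** A)"
  for A B :: "complex^'n^'n"
  by (simp_all add: vec_eq_iff matrix_matrix_mult_nth sum_negf)

lemma matrix_diff_mult: "(A - B) ** C = A ** C - B ** C" "C ** (A - B) = C ** A - C ** B"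
  for A B C :: "complex^'n^'n"
  by (simp_all add: vec_eq_iff matrix_matrix_mult_nth sum_subtractf algebra_simps)

lemma matrix_add_mult: "(A + B) ** C = A ** C + B ** C" "C ** (A + B) = C ** A + C ** B"
  for A B C :: "complex^'n^'n"
  by (simp_all add: vec_eq_iff matrix_matrix_mult_nth sum.distrib algebra_simps)

lemma matrix_scaleR_mult: "(r *\<^sub>R A) ** B = r *\<^sub>R (A ** B)" "A ** (r *\<^sub>R B) = r *\<^sub>R (A ** B)"
  for A B :: "complex^'n^'n"
  by (simp_all add: vec_eq_iff matrix_matrix_mult_nth scaleR_sum_right)

lemma normal_matrix_skew_hermitian: "skew_hermitian S \<Longrightarrow> normal_matrix S"
  by (simp add: skew_hermitian_def normal_matrix_def matrix_minus_mult)

text \<open>Conjugation by \<open>V\<close> carries eigenvectors to eigenvectors, which reduces the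
  claim to \<open>diag d\<close>: a nonzero coordinate \<open>i\<close> of an eigenvector forces the
  eigenvalue \<open>d i\<close>, and conversely \<open>axis i 1\<close> is an eigenvector for
  \<open>d i\<close>.\<close>

lemma spectrum_diagonalized:
  assumes V: "unitary_matrix V"
  shows "spectrum (V ** diag d ** conj_transpose V) = range d"
proof -
  let ?A = "V ** diag d ** conj_transpose V"
  have vec: "(diag d *v w) $ i = d i * w $ i" for w i
  proof -
    have "(diag d *v w) $ i = (\<Sum>k\<in>UNIV. if i = k then d i * w $ k else 0)"
      unfolding matrix_vector_mult_def vec_lambda_beta
      by (rule sum.cong) (auto simp: diag_nth)
    then show ?thesis by simp
  qed
  have "\<mu> \<in> range d" if \<mu>: "\<mu> \<in> spectrum ?A" for \<mu>
  proof -
    obtain v where v: "v \<noteq> 0" "?A *v v = \<mu> *s v" using \<mu> by (auto simp: spectrum_def)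
    define w where "w = conj_transpose V *v v"
    have "V *v w = v" using V by (simp add: w_def matrix_vector_mul_assoc unitary_matrix_cancel)
    with v(1) have "w \<noteq> 0" by auto
    then obtain i where i: "w $ i \<noteq> 0" by (auto simp: vec_eq_iff)
    have "diag d *v w = conj_transpose V *v (?A *v v)"
      using V by (simp add: w_def matrix_vector_mul_assoc matrix_mul_assoc[symmetric] unitary_matrix_cancel)
    also have "\<dots> = \<mu> *s w" by (simp add: v(2) w_def vector_scalar_commute)
    finally have "d i * w $ i = \<mu> * w $ i" using vec by (metis vector_smult_component)
    with i show ?thesis by auto
  qed
  moreover have "d i \<in> spectrum ?A" for i
  proof -
    define v where "v = V *v axis i 1"
    have "conj_transpose V *v v = axis i 1"
      using V by (simp add: v_def matrix_vector_mul_assoc unitary_matrix_cancel)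
    then have "?A *v v = V *v (diag d *v axis i 1)" "v \<noteq> 0"
      by (auto simp flip: matrix_vector_mul_assoc simp: axis_eq_0_iff)
    moreover have "diag d *v axis i 1 = d i *s axis i 1"
      using vec by (auto simp: vec_eq_iff axis_def)
    ultimately have "?A *v v = d i *s v" by (simp add: v_def vector_scalar_commute)
    with \<open>v \<noteq> 0\<close> show ?thesis by (auto simp: spectrum_def)
  qed
  ultimately show ?thesis by blast
qed

lemma unitary_matrix_diagonalized:
  assumes "unitary_matrix V" "unitary_matrix (V ** diag d ** conj_transpose V)"
  shows "cmod (d i) = 1"
proof -
  have "unitary_matrix (conj_transpose V ** (V ** diag d ** conj_transpose V) ** V)"
    by (intro unitary_matrix_mult[OF unitary_matrix_mult] unitary_matrix_conj_transpose assms)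
  moreover have "conj_transpose V ** (V ** diag d ** conj_transpose V) ** V = diag d"
    using assms(1) by (simp add: matrix_mul_assoc[symmetric] unitary_matrix_cancel)
  ultimately have "unitary_matrix (diag d)" by simp
  then show ?thesis by (simp add: unitary_matrix_diag)
qed

section \<open>Square roots of symmetric unitary matrices\<close>

text \<open>The library's \<open>inner\<close> on complex matrices is the real Frobenius inner
  product. Reading it column by column transfers adjointness from \<open>cinner\<close>.\<close>

lemma inner_matrix_columns:
  "inner A B = (\<Sum>j\<in>UNIV. Re (cinner (column j A) (column j B)))" for A B :: "complex^'n^'n"
  by (simp add: inner_vec_def cinner_def column_def inner_complex_def)
    (rule sum.swap)

lemma inner_matrix_adjoint:
  fixes A B U :: "complex^'n^'n"
  shows "inner A (U ** B) = inner (conj_transpose U ** A) B"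
proof -
  have "column j (C ** D) = C *v column j D" for C D :: "complex^'n^'n" and j
    by (simp add: vec_eq_iff column_def matrix_vector_mult_def matrix_matrix_mult_nth)
  then show ?thesis by (simp add: inner_matrix_columns cinner_adjoint)
qed

lemma inner_transpose: "inner (transpose A) (transpose B) = inner A B" for A B :: "complex^'n^'n"
  by (simp add: inner_vec_def) (rule sum.swap)

text \<open>Replacing \<open>Z\<close> by \<open>Y\<close>, its image under the adjoint of
  \<open>V\<close>, preserves the inner product and turns the quadratic form into a sum of squared
  moduli of entries with weights \<open>Re (d i)\<close>.\<close>

lemma accretive_diagonalized:
  fixes V Z :: "complex^'n^'n"
  assumes V: "unitary_matrix V" and c: "\<And>i. c \<le> Re (d i)"
  shows "c * inner Z Z \<le> inner Z (V ** diag d ** conj_transpose V ** Z)"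
proof -
  define Y where "Y = conj_transpose V ** Z"
  have ineq: "c * inner z z \<le> inner z (d i * z)" for z i
  proof -
    have "inner z (d i * z) = Re (d i) * inner z z"
      by (simp add: inner_complex_def algebra_simps)
    then show ?thesis using c[of i] by (simp add: mult_right_mono)
  qed
  have "c * inner Z Z = c * inner Y Y"
    using V inner_matrix_adjoint[of Y "conj_transpose V" Z]
    by (simp add: Y_def unitary_matrix_cancel)
  also have "\<dots> \<le> inner Y (diag d ** Y)"
    unfolding inner_vec_def by (simp add: sum_distrib_left) (intro sum_mono ineq)
  also have "\<dots> = inner Z (V ** diag d ** conj_transpose V ** Z)"
    using inner_matrix_adjoint[of Z V "diag d ** Y"] by (simp add: Y_def matrix_mul_assoc)
  finally show ?thesis .
qed

text \<open>Transposition preserves \<open>inner\<close> and turns right multiplication by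
  \<open>X\<close> into left multiplication by \<open>transpose X\<close>. Pairing with
  \<open>Z\<close> and applying Cauchy-Schwarz gives the bound. The constant comes from
  \<open>X\<close> alone, so it is uniform over all accretive \<open>Y\<close>.\<close>

lemma sylvester_lower_bound:
  fixes X Y Z :: "complex^'n^'n"
  assumes Y: "0 \<le> inner Z (Y ** Z)"
    and X: "\<And>A :: complex^'n^'n. c * inner A A \<le> inner A (transpose X ** A)"
  shows "c * norm Z \<le> norm (Y ** Z + Z ** X)"
proof -
  have "inner Z (Z ** X) = inner (transpose Z) (transpose X ** transpose Z)"
    by (simp flip: matrix_transpose_mul add: inner_transpose)
  with X[of "transpose Z"] have "c * inner Z Z \<le> inner Z (Z ** X)" by (simp add: inner_transpose)
  with Y have "c * inner Z Z \<le> inner Z (Y ** Z + Z ** X)" by (simp add: inner_add_right)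
  also have "\<dots> \<le> norm Z * norm (Y ** Z + Z ** X)" by (rule norm_cauchy_schwarz)
  finally show ?thesis
    by (cases "Z = 0") (auto simp: power2_norm_eq_inner[symmetric] power2_eq_square)
qed

lemma Usym_plus_diagonalization:
  assumes "X \<in> Usym_plus"
  obtains V d where "unitary_matrix V" "X = V ** diag d ** conj_transpose V"
    "\<And>i. 0 < Re (d i)" "\<And>i. cmod (d i) = 1"
proof -
  have X: "unitary_matrix X" "\<forall>\<mu>\<in>spectrum X. Re \<mu> > 0"
    using assms by (auto simp: Usym_plus_def)
  obtain V d where V: "unitary_matrix V" "X = V ** diag d ** conj_transpose V"
    using normal_matrix_diagonalization[OF normal_matrix_unitary[OF X(1)]] .
  show ?thesis
  proof (rule that[OF V])
    show "0 < Re (d i)" for i using X(2) spectrum_diagonalized[OF V(1), of d] V(2) by auto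
    show "cmod (d i) = 1" for i using unitary_matrix_diagonalized V X(1) by metis
  qed
qed

lemma accretive_Usym_plus:
  fixes X :: "complex^'n^'n"
  assumes "X \<in> Usym_plus"
  obtains c where "c > 0" "\<And>Z :: complex^'n^'n. c * inner Z Z \<le> inner Z (X ** Z)"
proof -
  obtain V d where V: "unitary_matrix V" "X = V ** diag d ** conj_transpose V"
    "\<And>i. 0 < Re (d i)"
    using Usym_plus_diagonalization[OF assms] by metis
  \<comment> \<open>The least real part among the finitely many eigenvalues, hence positive.\<close>
  define c where "c = Min (range (\<lambda>i. Re (d i)))"
  have "c > 0" using V(3) by (simp add: c_def)
  moreover have "c \<le> Re (d i)" for i by (simp add: c_def)
  ultimately show ?thesis
    using that[of c] accretive_diagonalized[OF V(1), of c d] by (simp add: V(2))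
qed

lemma Usym_plus_inner_nonneg:
  fixes X Z :: "complex^'n^'n"
  assumes "X \<in> Usym_plus"
  shows "0 \<le> inner Z (X ** Z)"
proof -
  obtain c where "c > 0" "c * inner Z Z \<le> inner Z (X ** Z)"
    using accretive_Usym_plus[OF assms] by metis
  then show ?thesis by (smt (verit) inner_ge_zero mult_nonneg_nonneg)
qed

text \<open>Since \<open>Y\<^sup>2 - X\<^sup>2 = Y (Y - X) + (Y - X) X\<close>, a Sylvester equation controls the
  square root.\<close>

lemma Usym_plus_square_root_Lipschitz:
  fixes X :: "complex^'n^'n"
  assumes "X \<in> Usym_plus"
  obtains c where "c > 0"
    "\<forall>Y\<in>Usym_plus. c * norm (Y - X) \<le> norm (Y ** Y - X ** X)"
    "\<forall>Z :: complex^'n^'n. c * norm Z \<le> norm (X ** Z + Z ** X)"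
proof -
  obtain c where c: "c > 0" "\<And>Z :: complex^'n^'n. c * inner Z Z \<le> inner Z (X ** Z)"
    using accretive_Usym_plus[OF assms] by blast
  have X: "transpose X = X" using assms by (simp add: Usym_plus_def)
  have *: "c * norm Z \<le> norm (Y ** Z + Z ** X)" if "Y \<in> Usym_plus" for Y and Z :: "complex^'n^'n"
    using sylvester_lower_bound[OF Usym_plus_inner_nonneg[OF that], of c X] c(2) by (simp add: X)
  have "Y ** (Y - X) + (Y - X) ** X = Y ** Y - X ** X" for Y
    by (simp add: matrix_diff_mult)
  with * have "\<forall>Y\<in>Usym_plus. c * norm (Y - X) \<le> norm (Y ** Y - X ** X)" by metis
  from that[OF c(1) this] show ?thesis using *[OF assms] by blast
qed

lemma Usym_plus_square_eq:
  assumes "X \<in> Usym_plus" "Y \<in> Usym_plus" "X ** X = Y ** Y"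
  shows "X = Y"
  using Usym_plus_square_root_Lipschitz[OF assms(1)] assms
  by (smt (verit) mult_pos_pos norm_eq_zero norm_ge_zero eq_iff_diff_eq_0 diff_self norm_zero)

text \<open>Principal square roots of the eigenvalues give a unitary root \<open>X\<close> with
  eigenvalues in the open right half plane. Its symmetry is not visible from the diagonalization,
  because \<open>V\<close> need not be real; it follows from uniqueness of accretive roots.\<close>

lemma Usym_plus_square_root_exists:
  fixes U :: "complex^'n^'n"
  assumes U: "unitary_matrix U" and sym: "transpose U = U" and sp: "- 1 \<notin> spectrum U"
  obtains X where "X \<in> Usym_plus" "X ** X = U"
proof -
  obtain V d where V: "unitary_matrix V" and Ud: "U = V ** diag d ** conj_transpose V"
    using normal_matrix_diagonalization[OF normal_matrix_unitary[OF U]] .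
  define s where "s i = csqrt (d i)" for i
  have nd: "cmod (d i) = 1" for i using unitary_matrix_diagonalized V U Ud by metis
  have dm: "d i \<noteq> - 1" for i using spectrum_diagonalized[OF V, of d] sp Ud by (metis rangeI)
  have pos: "0 < Re (s i)" for i
  proof (rule ccontr)
    \<comment> \<open>A principal root has nonnegative real part. If that part were 0, the square
      would be a nonpositive real of modulus 1, that is, the excluded eigenvalue -1.\<close>
    assume "\<not> 0 < Re (s i)"
    then have "Re (s i) = 0" using csqrt_principal[of "d i"] by (auto simp: s_def)
    then have sI: "s i = \<i> * of_real (Im (s i))" by (simp add: complex_eq_iff)
    have "d i = (s i)\<^sup>2" by (simp add: s_def)
    also have "\<dots> = - of_real ((Im (s i))\<^sup>2)" by (subst sI) (simp add: power_mult_distrib)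
    finally have di: "d i = - of_real ((Im (s i))\<^sup>2)" .
    have "(Im (s i))\<^sup>2 = 1" using nd[of i] by (subst (asm) di) (simp add: norm_power)
    with di dm[of i] show False by simp
  qed
  have s1: "cmod (s i) = 1" for i by (simp add: s_def nd)
  define X where "X = V ** diag s ** conj_transpose V"
  have XX: "X ** X = U"
    using V by (simp add: X_def Ud matrix_mul_assoc[symmetric] unitary_matrix_cancel)
      (simp add: matrix_mul_assoc diag_mult_diag s_def power2_eq_square[symmetric])
  have X: "unitary_matrix X"
    unfolding X_def using V s1
    by (intro unitary_matrix_mult unitary_matrix_conj_transpose) (auto simp: unitary_matrix_diag)
  \<comment> \<open>The entrywise conjugate of \<open>V\<close>; it diagonalizes
    \<open>transpose X\<close> with the same eigenvalues, so \<open>transpose X\<close> is accretive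
    too.\<close>
  define Q where "Q = transpose (conj_transpose V)"
  have Q: "unitary_matrix Q"
    by (simp add: Q_def V unitary_matrix_transpose unitary_matrix_conj_transpose)
  have tX: "transpose X = Q ** diag s ** conj_transpose Q"
    by (simp add: X_def Q_def matrix_transpose_mul transpose_diag matrix_mul_assoc
        transpose_conj_transpose)
  define c where "c = Min (range (\<lambda>i. Re (s i)))"
  have c: "c > 0" "\<And>i. c \<le> Re (s i)" using pos by (simp_all add: c_def)
  \<comment> \<open>Both \<open>transpose X\<close> and \<open>X\<close> square to \<open>U\<close>,
    so the Sylvester expression vanishes. \<open>Usym_plus_square_eq\<close> cannot be quoted here,
    since membership in \<open>Usym_plus\<close> already includes symmetry.\<close>
  have "c * norm (transpose X - X) \<le> norm (transpose X ** (transpose X - X) + (transpose X - X) ** X)"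
  proof (rule sylvester_lower_bound)
    show "0 \<le> inner (transpose X - X) (transpose X ** (transpose X - X))"
      using accretive_diagonalized[OF Q, of 0 s "transpose X - X"] pos
      by (simp add: tX less_imp_le)
    show "c * inner A A \<le> inner A (transpose X ** A)" for A :: "complex^'n^'n"
      unfolding tX by (rule accretive_diagonalized[OF Q c(2)])
  qed
  also have "transpose X ** (transpose X - X) + (transpose X - X) ** X = transpose (X ** X) - X ** X"
    by (simp add: matrix_diff_mult matrix_transpose_mul)
  finally have "transpose X = X" using c(1) by (simp add: XX sym mult_le_0_iff)
  then have "X \<in> Usym_plus"
    using X pos spectrum_diagonalized[OF V, of s] by (auto simp: Usym_plus_def X_def)
  from that[OF this XX] show ?thesis .
qed

section \<open>The factorization\<close>

text \<open>For a unitary \<open>Q\<close> with \<open>transpose Q ** Q = mat 1\<close>, transpose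
  and adjoint are both the inverse of \<open>Q\<close>; their equality says that all entries are
  real.\<close>

lemma real_orthogonal_iff:
  "Q \<in> real_orthogonal \<longleftrightarrow> unitary_matrix Q \<and> transpose Q ** Q = mat 1"
proof
  assume "Q \<in> real_orthogonal"
  then obtain R where R: "Q = map_matrix complex_of_real R" "transpose R ** R = mat 1"
    by (auto simp: real_orthogonal_def orthogonal_matrix)
  have "transpose Q ** Q = map_matrix complex_of_real (transpose R ** R)"
    by (simp add: vec_eq_iff matrix_matrix_mult_def R(1) map_matrix_def)
  also have "\<dots> = mat 1" by (simp add: R(2) vec_eq_iff mat_def map_matrix_def)
  finally have "transpose Q ** Q = mat 1" .
  moreover have "conj_transpose Q = transpose Q" by (simp add: R(1) vec_eq_iff map_matrix_def)
  ultimately show "unitary_matrix Q \<and> transpose Q ** Q = mat 1"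
    by (simp add: unitary_matrix_iff_left)
next
  assume Q: "unitary_matrix Q \<and> transpose Q ** Q = mat 1"
  then have "transpose Q = transpose Q ** (Q ** conj_transpose Q)"
    by (simp add: unitary_matrix_cancel)
  also have "\<dots> = conj_transpose Q" using Q by (simp add: matrix_mul_assoc)
  finally have "Q $ i $ j = cnj (Q $ i $ j)" for i j
    by (metis conj_transpose_nth transpose_nth)
  then have re: "Q $ i $ j = of_real (Re (Q $ i $ j))" for i j
    by (metis Reals_cnj_iff of_real_Re)
  define R where "R = (\<chi> i j. Re (Q $ i $ j))"
  have R: "Q = map_matrix complex_of_real R"
    using re by (simp add: R_def vec_eq_iff map_matrix_def)
  have "map_matrix complex_of_real (transpose R ** R) = transpose Q ** Q"
    by (simp add: vec_eq_iff matrix_matrix_mult_def R map_matrix_def)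
  also have "\<dots> = map_matrix complex_of_real (mat 1)" using Q by (simp add: vec_eq_iff mat_def map_matrix_def)
  finally have "transpose R ** R = mat 1"
    by (simp add: vec_eq_iff map_matrix_def)
  then show "Q \<in> real_orthogonal" by (auto simp: real_orthogonal_def orthogonal_matrix R)
qed

text \<open>Eliminates the orthogonal factor, leaving the symmetric factor as a square root of a
  matrix determined by the product.\<close>

lemma factorization_square:
  assumes "Q \<in> real_orthogonal" "X \<in> Usym_plus"
  shows "X ** X = transpose (Q ** X) ** (Q ** X)"
proof -
  have "transpose (Q ** X) ** (Q ** X) = transpose X ** (transpose Q ** Q) ** X"
    by (simp add: matrix_transpose_mul matrix_mul_assoc)
  then show ?thesis using assms by (simp add: real_orthogonal_iff Usym_plus_def)
qed

text \<open>The symmetric factor must be the root of \<open>transpose W ** W\<close> in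
  \<open>Usym_plus\<close>, which exists and is unique; the other factor is then obtained by
  cancelling it on the right.\<close>

lemma factorization_ex1:
  fixes W :: "complex^'n^'n"
  assumes "W \<in> UU"
  shows "\<exists>!P. P \<in> real_orthogonal \<times> Usym_plus \<and> W = fst P ** snd P"
proof (rule ex_ex1I)
  have W: "unitary_matrix W" using assms by (simp add: UU_def)
  obtain X where X: "X \<in> Usym_plus" "X ** X = transpose W ** W"
    using Usym_plus_square_root_exists[of "transpose W ** W"] assms
    by (auto simp: UU_def matrix_transpose_mul unitary_matrix_mult unitary_matrix_transpose)
  have Xu: "unitary_matrix X" "transpose X = X" using X(1) by (auto simp: Usym_plus_def)
  define Q where "Q = W ** conj_transpose X"
  have "transpose Q ** Q = conj_transpose X ** (transpose W ** W) ** conj_transpose X"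
    by (simp add: Q_def matrix_transpose_mul transpose_conj_transpose Xu matrix_mul_assoc)
  also have "\<dots> = mat 1"
    using Xu(1) by (simp add: X(2)[symmetric] matrix_mul_assoc[symmetric] unitary_matrix_cancel)
  finally have "Q \<in> real_orthogonal"
    by (simp add: real_orthogonal_iff Q_def W Xu unitary_matrix_mult unitary_matrix_conj_transpose)
  moreover have "W = Q ** X"
    using Xu(1) by (simp add: Q_def matrix_mul_assoc[symmetric] unitary_matrix_cancel)
  ultimately show "\<exists>P. P \<in> real_orthogonal \<times> Usym_plus \<and> W = fst P ** snd P"
    using X(1) by (intro exI[of _ "(Q, X)"]) simp
next
  fix P P' :: "(complex^'n^'n) \<times> (complex^'n^'n)"
  assume *: "P \<in> real_orthogonal \<times> Usym_plus \<and> W = fst P ** snd P"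
    "P' \<in> real_orthogonal \<times> Usym_plus \<and> W = fst P' ** snd P'"
  then have S: "snd P \<in> Usym_plus" "snd P' \<in> Usym_plus" by auto
  have "snd P ** snd P = snd P' ** snd P'"
    using * factorization_square[of "fst P" "snd P"] factorization_square[of "fst P'" "snd P'"] by auto
  then have eq: "snd P = snd P'" using Usym_plus_square_eq S by blast
  have u: "unitary_matrix (snd P)" using S by (simp add: Usym_plus_def)
  have "fst P = fst P ** (snd P ** conj_transpose (snd P))"
    using u by (simp add: unitary_matrix_cancel)
  also have "\<dots> = fst P' ** (snd P ** conj_transpose (snd P))"
    using * eq by (metis matrix_mul_assoc)
  also have "\<dots> = fst P'" using u by (simp add: unitary_matrix_cancel)
  finally show "P = P'" using eq by (simp add: prod_eq_iff)
qed

lemma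
  assumes "W \<in> UU"
  shows Phi1_in: "Phi1 W \<in> real_orthogonal"
    and Phi2_in: "Phi2 W \<in> Usym_plus"
    and Phi1_mult_Phi2: "Phi1 W ** Phi2 W = W"
  using theI'[OF factorization_ex1[OF assms]] by (auto simp: Phi1_def Phi2_def Phi_def)

lemma Phi2_square: "W \<in> UU \<Longrightarrow> Phi2 W ** Phi2 W = transpose W ** W"
  using factorization_square[OF Phi1_in Phi2_in] Phi1_mult_Phi2 by metis

lemma Phi1_eq: "W \<in> UU \<Longrightarrow> Phi1 W = W ** conj_transpose (Phi2 W)"
  using Phi2_in[of W] Phi1_mult_Phi2[of W]
  by (metis (no_types, lifting) Usym_plus_def matrix_mul_assoc matrix_mul_rid mem_Collect_eq
      unitary_matrix_cancel(2))

lemma Phi_eqI: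
  assumes "W \<in> UU" "W\<^sub>1 \<in> real_orthogonal" "W\<^sub>2 \<in> Usym_plus" "W = W\<^sub>1 ** W\<^sub>2"
  shows "Phi1 W = W\<^sub>1" "Phi2 W = W\<^sub>2"
proof -
  have "Phi W = (W\<^sub>1, W\<^sub>2)"
    unfolding Phi_def by (rule the1_equality[OF factorization_ex1]) (use assms in auto)
  then show "Phi1 W = W\<^sub>1" "Phi2 W = W\<^sub>2" by (simp_all add: Phi1_def Phi2_def)
qed

section \<open>Differentiability and tangential derivatives\<close>

lemma bounded_bilinear_matrix_mult:
  "bounded_bilinear ((**) :: complex^'n^'n \<Rightarrow> complex^'n^'n \<Rightarrow> complex^'n^'n)"
  unfolding bilinear_conv_bounded_bilinear[symmetric] bilinear_def
  by (auto intro!: linearI simp: matrix_add_mult matrix_scaleR_mult)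

lemmas has_derivative_matrix_mult = bounded_bilinear.FDERIV[OF bounded_bilinear_matrix_mult]

lemma bounded_linear_transpose: "bounded_linear (transpose :: complex^'n^'n \<Rightarrow> complex^'n^'n)"
  unfolding linear_conv_bounded_linear[symmetric]
  by (auto intro!: linearI simp: vec_eq_iff)

lemma bounded_linear_conj_transpose:
  "bounded_linear (conj_transpose :: complex^'n^'n \<Rightarrow> complex^'n^'n)"
  unfolding linear_conv_bounded_linear[symmetric]
  by (auto intro!: linearI simp: vec_eq_iff)

lemma has_derivative_transpose_mult_self:
  fixes W :: "complex^'n^'n"
  shows "((\<lambda>A. transpose A ** A) has_derivative (\<lambda>H. transpose W ** H + transpose H ** W))
    (at W within S)"
  by (rule has_derivative_matrix_mult[OF bounded_linear.has_derivative[OF bounded_linear_transpose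
          has_derivative_ident] has_derivative_ident])

text \<open>The domination forces \<open>f x = 0\<close> and squeezes the difference quotients; it
  serves to discard the quadratic remainder of the square root.\<close>

lemma has_derivative_zero_dominated:
  assumes "x \<in> S" "\<And>y. y \<in> S \<Longrightarrow> norm (f y) \<le> g y" "g x = 0"
    and g: "(g has_derivative (\<lambda>_. 0)) (at x within S)"
  shows "(f has_derivative (\<lambda>_. 0)) (at x within S)"
proof -
  have lim: "((\<lambda>y. (1 / norm (y - x)) *\<^sub>R g y) \<longlongrightarrow> 0) (at x within S)"
    using g assms(3) by (simp add: has_derivative_within)
  have fx: "f x = 0" using assms(2)[OF assms(1)] assms(3) by simp
  have "norm ((1 / norm (y - x)) *\<^sub>R f y) \<le> (1 / norm (y - x)) *\<^sub>R g y" if "y \<in> S" for y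
    using assms(2)[OF that] by (simp add: divide_right_mono)
  then have "eventually (\<lambda>y. norm ((1 / norm (y - x)) *\<^sub>R f y) \<le> (1 / norm (y - x)) *\<^sub>R g y)
      (at x within S)"
    by (auto simp only: eventually_at intro!: exI[of _ 1] zero_less_one)
  from Lim_null_comparison[OF this lim] show ?thesis
    by (simp add: has_derivative_within fx)
qed

text \<open>With \<open>Z = Phi2 A - X\<close>, subtracting the two squares gives
  \<open>L Z + Z ** Z = F A - F W\<close>. Applying a left inverse \<open>G\<close> of
  \<open>L\<close> expresses \<open>Phi2 A\<close> through the differentiable \<open>F\<close>, up
  to \<open>G (Z ** Z)\<close>, which is quadratic in \<open>F A - F W\<close> by the Lipschitz
  bound.\<close>

lemma Phi2_differentiable:
  fixes W :: "complex^'n^'n"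
  assumes "W \<in> UU"
  shows "Phi2 differentiable (at W within UU)"
proof -
  define X where "X = Phi2 W"
  define F where "F A = transpose A ** A" for A :: "complex^'n^'n"
  define L where "L Z = X ** Z + Z ** X" for Z
  obtain c where c: "c > 0"
    "\<forall>Y\<in>Usym_plus. c * norm (Y - X) \<le> norm (Y ** Y - X ** X)"
    "\<forall>Z :: complex^'n^'n. c * norm Z \<le> norm (X ** Z + Z ** X)"
    using Usym_plus_square_root_Lipschitz[OF Phi2_in[OF assms]] unfolding X_def .
  have L: "linear L"
    by (rule linearI)
      (simp_all add: L_def matrix_add_mult matrix_scaleR_mult scaleR_right_distrib add_ac)
  have "Z = 0" if "L Z = 0" for Z
    using c(1) spec[OF c(3), of Z] that unfolding L_def by (simp add: mult_le_0_iff)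
  then have "inj L" using linear_injective_0[OF L] by blast
  then obtain G where G: "linear G" "G \<circ> L = id"
    using linear_injective_left_inverse[OF L] by blast
  have GL: "G (L Z) = Z" for Z using fun_cong[OF G(2), of Z] by simp
  have bG: "bounded_linear G" using G(1) by (simp add: linear_conv_bounded_linear)
  obtain B where B: "B > 0" "\<And>Z. norm (G Z) \<le> norm Z * B"
    using bounded_linear.pos_bounded[OF bG] by blast
  obtain K where K: "K > 0"
    "norm (A ** A') \<le> norm A * norm A' * K" for A A' :: "complex^'n^'n"
    using bounded_bilinear.pos_bounded[OF bounded_bilinear_matrix_mult] by blast
  define R where "R A = G ((Phi2 A - X) ** (Phi2 A - X))" for A
  have expand: "Phi2 A = X + G (F A - F W) - R A" if "A \<in> UU" for A
  proof -
    have "L (Phi2 A - X) + (Phi2 A - X) ** (Phi2 A - X) = Phi2 A ** Phi2 A - X ** X"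
      by (simp add: L_def matrix_diff_mult)
    also have "\<dots> = F A - F W"
      unfolding F_def X_def Phi2_square[OF that] Phi2_square[OF assms] ..
    finally have "G (F A - F W) = G (L (Phi2 A - X)) + R A"
      unfolding R_def by (metis linear_add[OF G(1)])
    then show ?thesis unfolding GL by simp
  qed
  \<comment> \<open>\<open>K\<close> bounds the matrix product, \<open>B\<close> bounds
    \<open>G\<close>, and each factor \<open>Phi2 A - X\<close> contributes one Lipschitz constant
    \<open>1 / c\<close>.\<close>
  define C where "C = K * B / c\<^sup>2"
  have R_bound: "norm (R A) \<le> C * inner (F A - F W) (F A - F W)" if "A \<in> UU" for A
  proof -
    let ?Z = "Phi2 A - X"
    have "c * norm ?Z \<le> norm (F A - F W)"
      using bspec[OF c(2) Phi2_in[OF that]] Phi2_square[OF that] Phi2_square[OF assms]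
      by (simp add: F_def X_def)
    then have "norm ?Z \<le> norm (F A - F W) / c" using c(1) by (simp add: field_simps)
    then have Z: "norm ?Z * norm ?Z \<le> (norm (F A - F W) / c) * (norm (F A - F W) / c)"
      using c(1) by (intro mult_mono) auto
    have "norm (R A) \<le> norm (?Z ** ?Z) * B" unfolding R_def by (rule B(2))
    also have "\<dots> \<le> (norm ?Z * norm ?Z * K) * B" using K(2) B(1) by (intro mult_right_mono) auto
    also have "\<dots> \<le> ((norm (F A - F W) / c) * (norm (F A - F W) / c) * K) * B"
      using Z K(1) B(1) by (intro mult_right_mono) auto
    also have "\<dots> = C * inner (F A - F W) (F A - F W)"
      by (simp add: C_def power2_norm_eq_inner[symmetric] power2_eq_square)
    finally show ?thesis .
  qed
  have dF: "(F has_derivative (\<lambda>H. transpose W ** H + transpose H ** W)) (at W within UU)"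
    unfolding F_def by (rule has_derivative_transpose_mult_self)
  have dF': "((\<lambda>A. F A - F W) has_derivative (\<lambda>H. transpose W ** H + transpose H ** W)) (at W within UU)"
    using has_derivative_diff[OF dF has_derivative_const[of "F W"]] by simp
  \<comment> \<open>Both terms of the product rule contain \<open>F W - F W\<close>, so the
    derivative at \<open>W\<close> is 0.\<close>
  have "((\<lambda>A. C * inner (F A - F W) (F A - F W)) has_derivative (\<lambda>_. 0)) (at W within UU)"
    using has_derivative_mult_right[OF has_derivative_inner[OF dF' dF'], of C] by simp
  from has_derivative_zero_dominated[OF assms R_bound _ this]
  have dR: "(R has_derivative (\<lambda>_. 0)) (at W within UU)"
    by simp
  have "((\<lambda>A. X + G (F A - F W) - R A) has_derivative
      (\<lambda>H. 0 + G (transpose W ** H + transpose H ** W) - 0)) (at W within UU)"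
    by (rule has_derivative_diff[OF has_derivative_add[OF has_derivative_const
            bounded_linear.has_derivative[OF bG dF']] dR])
  from has_derivative_transform[OF assms expand this] show ?thesis
    by (rule differentiableI)
qed

lemma Phi1_differentiable:
  fixes W :: "complex^'n^'n"
  assumes "W \<in> UU"
  shows "Phi1 differentiable (at W within UU)"
proof -
  obtain D where "(Phi2 has_derivative D) (at W within UU)"
    using Phi2_differentiable[OF assms] by (auto simp: differentiable_def)
  then have "((\<lambda>A. A ** conj_transpose (Phi2 A)) has_derivative
      (\<lambda>H. W ** conj_transpose (D H) + H ** conj_transpose (Phi2 W))) (at W within UU)"
    by (intro has_derivative_matrix_mult has_derivative_ident
        bounded_linear.has_derivative[OF bounded_linear_conj_transpose])
  from has_derivative_transform[OF assms Phi1_eq this] show ?thesis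
    by (rule differentiableI)
qed

section \<open>Tangent curves and derivatives in tangent directions\<close>

lemma has_derivative_vec_componentwise:
  fixes f :: "'a::real_normed_vector \<Rightarrow> 'b::real_normed_vector^'n"
  assumes "\<And>i. ((\<lambda>x. f x $ i) has_derivative (\<lambda>h. f' h $ i)) (at x within S)"
    and "bounded_linear f'"
  shows "(f has_derivative f') (at x within S)"
  unfolding has_derivative_within
proof (intro conjI vec_tendstoI)
  show "((\<lambda>y. ((1 / norm (y - x)) *\<^sub>R (f y - (f x + f' (y - x)))) $ i) \<longlongrightarrow> 0 $ i) (at x within S)" for i
    using assms(1)[of i] by (simp add: has_derivative_within)
qed (rule assms(2))

lemma has_derivative_diag_exp:
  "((\<lambda>t. diag (\<lambda>i. exp (of_real t * d i))) has_derivative (\<lambda>h. h *\<^sub>R diag d)) (at (0::real))"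
proof (intro has_derivative_vec_componentwise)
  fix i j
  have "((\<lambda>z. exp (z * d i)) has_field_derivative d i) (at (of_real 0))"
    by (auto intro!: derivative_eq_intros)
  from has_vector_derivative_real_field[OF this, of UNIV]
  show "((\<lambda>t. diag (\<lambda>i. exp (of_real t * d i)) $ i $ j) has_derivative
      (\<lambda>h. (h *\<^sub>R diag d) $ i $ j)) (at (0::real))"
    by (cases "i = j") (simp_all add: diag_nth has_vector_derivative_def)
  show "bounded_linear (\<lambda>h. (h *\<^sub>R diag d) $ i)"
    by (auto intro!: bounded_linear_intros simp: bounded_linear_scaleR_left)
qed (rule bounded_linear_scaleR_left)

text \<open>Rewriting the spectral condition as a vanishing determinant makes its negation stable
  under small perturbations, by continuity.\<close>

lemma minus_1_in_spectrum_iff: "- 1 \<in> spectrum A \<longleftrightarrow> det (A + mat 1) = 0"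
proof -
  have "(A + mat 1) *v v = 0 \<longleftrightarrow> A *v v = - 1 *s v" for v
    by (simp add: matrix_vector_mult_add_rdistrib eq_neg_iff_add_eq_0 vector_smult_lneg)
  then have "- 1 \<notin> spectrum A \<longleftrightarrow> (\<forall>v. (A + mat 1) *v v = 0 \<longrightarrow> v = 0)"
    by (auto simp: spectrum_def)
  also have "\<dots> \<longleftrightarrow> det (A + mat 1) \<noteq> 0"
    unfolding matrix_left_invertible_ker[symmetric] invertible_left_inverse[symmetric]
      invertible_det_nz ..
  finally show ?thesis by blast
qed

lemma continuous_on_det: "continuous_on S (det :: complex^'n^'n \<Rightarrow> complex)"
  unfolding det_def by (intro continuous_intros)

lemma skew_hermitian_diagonalization:
  assumes "skew_hermitian S"
  obtains V d where "unitary_matrix V" "S = V ** diag d ** conj_transpose V" "\<And>i. Re (d i) = 0"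
proof -
  obtain V d where V: "unitary_matrix V" "S = V ** diag d ** conj_transpose V"
    using normal_matrix_diagonalization[OF normal_matrix_skew_hermitian[OF assms]] .
  have diag: "diag d = conj_transpose V ** S ** V"
    using V(1) by (simp add: V(2) matrix_mul_assoc[symmetric] unitary_matrix_cancel)
  have "conj_transpose (diag d) = conj_transpose V ** conj_transpose S ** V"
    unfolding diag by (simp add: conj_transpose_mult matrix_mul_assoc)
  also have "\<dots> = - diag d"
    using assms unfolding diag skew_hermitian_def by (simp add: matrix_minus_mult)
  finally have eq: "conj_transpose (diag d) = - diag d" .
  have "cnj (d i) = - d i" for i
    using arg_cong[OF eq, of "\<lambda>A. A $ i $ i"] by (simp add: diag_nth)
  then have "Re (cnj (d i)) = Re (- d i)" for i by (rule arg_cong)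
  then have "Re (d i) = 0" for i by simp
  from that[OF V this] show ?thesis .
qed

text \<open>The curve is \<open>W\<close> times the exponential of \<open>t\<close> times
  \<open>S\<close>, written in an eigenbasis of \<open>S\<close>. It stays unitary because the
  eigenvalues of \<open>S\<close> are imaginary, and the determinant condition persists for small
  \<open>t\<close>.\<close>

lemma UU_tangent_curve:
  fixes W S :: "complex^'n^'n"
  assumes W: "W \<in> UU" and S: "skew_hermitian S"
  obtains \<gamma> e where "e > 0" "\<gamma> 0 = W" "\<gamma> ` ball 0 e \<subseteq> UU"
    "(\<gamma> has_derivative (\<lambda>h. h *\<^sub>R (W ** S))) (at (0::real))"
proof -
  obtain V d where V: "unitary_matrix V" "S = V ** diag d ** conj_transpose V" "\<And>i. Re (d i) = 0"
    using skew_hermitian_diagonalization[OF S] by metis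
  define \<gamma> where "\<gamma> t = W ** (V ** diag (\<lambda>i. exp (of_real t * d i)) ** conj_transpose V)" for t :: real
  note left = bounded_bilinear.bounded_linear_left[OF bounded_bilinear_matrix_mult]
    and right = bounded_bilinear.bounded_linear_right[OF bounded_bilinear_matrix_mult]
  have "bounded_linear (\<lambda>A. W ** (V ** A ** conj_transpose V))"
    by (rule bounded_linear_compose[OF right bounded_linear_compose[OF left right]])
  from bounded_linear.has_derivative[OF this has_derivative_diag_exp[of d]]
  have der: "(\<gamma> has_derivative (\<lambda>h. h *\<^sub>R (W ** S))) (at 0)"
    by (simp add: \<gamma>_def[abs_def] matrix_scaleR_mult V(2))
  have "diag (\<lambda>i. 1) = (mat 1 :: complex^'n^'n)" by (simp add: vec_eq_iff diag_nth mat_def)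
  then have \<gamma>0: "\<gamma> 0 = W" using V(1) by (simp add: \<gamma>_def unitary_matrix_cancel)
  have u: "unitary_matrix (\<gamma> t)" for t
    unfolding \<gamma>_def using W V
    by (intro unitary_matrix_mult unitary_matrix_conj_transpose)
      (auto simp: UU_def unitary_matrix_diag norm_exp_eq_Re)
  define f where "f t = det (transpose (\<gamma> t) ** \<gamma> t + mat 1)" for t
  have c\<gamma>: "isCont \<gamma> 0" using der by (rule has_derivative_continuous)
  have "isCont (\<lambda>t. transpose (\<gamma> t) ** \<gamma> t + mat 1) 0"
    by (intro continuous_intros bounded_bilinear.continuous[OF bounded_bilinear_matrix_mult]
        bounded_linear.isCont[OF bounded_linear_transpose] c\<gamma>)
  moreover have "isCont det A" for A :: "complex^'n^'n"
    using continuous_on_det[of "UNIV :: (complex^'n^'n) set"] by (simp add: continuous_on_eq_continuous_at)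
  ultimately have "isCont f 0" unfolding f_def by (rule isCont_o2)
  moreover have "f 0 \<noteq> 0"
    using W minus_1_in_spectrum_iff by (auto simp: f_def \<gamma>0 UU_def)
  ultimately obtain e where e: "e > 0" "\<And>t. dist 0 t < e \<Longrightarrow> f t \<noteq> 0"
    using continuous_at_avoid[of 0 f 0] by blast
  then have "\<gamma> ` ball 0 e \<subseteq> UU"
    using u by (auto simp: UU_def f_def minus_1_in_spectrum_iff)
  from that[OF e(1) \<gamma>0 this der] show ?thesis .
qed

text \<open>A derivative within \<open>UU\<close> is not determined on the whole matrix space. Its
  values on tangent vectors are, since composing with a curve in \<open>UU\<close> reduces them to
  derivatives in one real variable. Identities valid only on \<open>UU\<close> can thus be
  differentiated tangentially.\<close>

lemma UU_tangent_derivative_unique: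
  fixes W S :: "complex^'n^'n" and f :: "complex^'n^'n \<Rightarrow> complex^'n^'n"
  assumes W: "W \<in> UU" and S: "skew_hermitian S"
    and f: "(f has_derivative f') (at W within UU)"
    and g: "(g has_derivative g') (at W within UU)"
    and eq: "\<And>A. A \<in> UU \<Longrightarrow> f A = g A"
  shows "f' (W ** S) = g' (W ** S)"
proof -
  obtain \<gamma> e where \<gamma>: "e > 0" "\<gamma> 0 = W" "\<gamma> ` ball 0 e \<subseteq> UU"
    and d\<gamma>: "(\<gamma> has_derivative (\<lambda>h. h *\<^sub>R (W ** S))) (at (0::real))"
    using UU_tangent_curve[OF W S] .
  have d\<gamma>': "(\<gamma> has_derivative (\<lambda>h. h *\<^sub>R (W ** S))) (at 0 within ball 0 e)"
    using d\<gamma> by (rule has_derivative_at_withinI)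
  have comp: "((\<lambda>t. k (\<gamma> t)) has_derivative (\<lambda>h. k' (h *\<^sub>R (W ** S)))) (at 0)"
    if "(k has_derivative k') (at W within UU)" for k k' :: "complex^'n^'n \<Rightarrow> complex^'n^'n"
    using has_derivative_in_compose[OF d\<gamma>', of k k'] has_derivative_subset[OF that \<gamma>(3)] \<gamma>(1,2)
    by (simp add: at_within_open[OF _ open_ball])
  have "((\<lambda>t. g (\<gamma> t)) has_derivative (\<lambda>h. g' (h *\<^sub>R (W ** S)))) (at 0 within ball 0 e)"
    using comp[OF g] by (rule has_derivative_at_withinI)
  then have "((\<lambda>t. f (\<gamma> t)) has_derivative (\<lambda>h. g' (h *\<^sub>R (W ** S)))) (at 0 within ball 0 e)"
    by (rule has_derivative_transform[rotated 2]) (use \<gamma>(1,3) in \<open>auto intro!: eq\<close>)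
  then have "((\<lambda>t. f (\<gamma> t)) has_derivative (\<lambda>h. g' (h *\<^sub>R (W ** S)))) (at 0)"
    using \<gamma>(1) by (simp add: at_within_open[OF _ open_ball])
  from has_derivative_unique[OF comp[OF f] this]
  have "f' (1 *\<^sub>R (W ** S)) = g' (1 *\<^sub>R (W ** S))" by (rule fun_cong)
  then show ?thesis by simp
qed

lemma Phi_derivative_equations:
  fixes W S :: "complex^'n^'n"
  assumes W: "W \<in> UU" and S: "skew_hermitian S"
    and D\<^sub>1: "(Phi1 has_derivative D\<^sub>1) (at W within UU)"
    and D\<^sub>2: "(Phi2 has_derivative D\<^sub>2) (at W within UU)"
  shows "Phi1 W ** D\<^sub>2 (W ** S) + D\<^sub>1 (W ** S) ** Phi2 W = W ** S"
    and "Phi2 W ** D\<^sub>2 (W ** S) + D\<^sub>2 (W ** S) ** Phi2 W =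
      transpose W ** (W ** S) + transpose (W ** S) ** W"
proof -
  show "Phi1 W ** D\<^sub>2 (W ** S) + D\<^sub>1 (W ** S) ** Phi2 W = W ** S"
    by (rule UU_tangent_derivative_unique[OF W S has_derivative_matrix_mult[OF D\<^sub>1 D\<^sub>2]
        has_derivative_ident Phi1_mult_Phi2])
  show "Phi2 W ** D\<^sub>2 (W ** S) + D\<^sub>2 (W ** S) ** Phi2 W =
      transpose W ** (W ** S) + transpose (W ** S) ** W"
    by (rule UU_tangent_derivative_unique[OF W S has_derivative_matrix_mult[OF D\<^sub>2 D\<^sub>2]
        has_derivative_transpose_mult_self Phi2_square])
qed

section \<open>Unitarily invariant norms of Schur multipliers\<close>

locale unitarily_invariant =
  fixes N :: "complex^'n^'n \<Rightarrow> real"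
  assumes unitarily_invariant: "unitarily_invariant_norm N"
begin

lemma
  shows N_nonneg: "0 \<le> N A"
    and N_zero: "N 0 = 0"
    and N_scale: "N (map_matrix ((*) c) A) = cmod c * N A"
    and N_triangle: "N (A + B) \<le> N A + N B"
  using unitarily_invariant by (auto simp: unitarily_invariant_norm_def matrix_norm_def)

lemma
  assumes "unitary_matrix U"
  shows N_unitary_left: "N (U ** A) = N A" and N_unitary_right: "N (A ** U) = N A"
proof -
  have "conj_transpose (mat 1) = (mat 1 :: complex^'n^'n)"
    by (auto simp: vec_eq_iff mat_def)
  then have mat1: "unitary_matrix (mat 1 :: complex^'n^'n)"
    by (simp add: unitary_matrix_iff_left)
  have inv: "N (U ** A ** V) = N A" if "unitary_matrix U" "unitary_matrix V" for U V A
    using unitarily_invariant that by (auto simp: unitarily_invariant_norm_def)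
  show "N (U ** A) = N A" using inv[OF assms mat1] by simp
  show "N (A ** U) = N A" using inv[OF mat1 assms] by simp
qed

lemma N_uminus: "N (- A) = N A"
proof -
  have "map_matrix ((*) (- 1)) A = - A" by (simp add: vec_eq_iff map_matrix_def)
  then show ?thesis using N_scale[of "- 1" A] by simp
qed

lemma N_diff_le: "N (A - B) \<le> N A + N B"
  using N_triangle[of A "- B"] by (simp add: N_uminus)

lemma N_sum: "N (sum f F) \<le> (\<Sum>x\<in>F. N (f x))"
proof (induction F rule: infinite_finite_induct)
  case (insert x F)
  then show ?case using N_triangle[of "f x" "sum f F"] by simp
qed (simp_all add: N_zero)

text \<open>Expansion in the matrix units \<open>E i j\<close>. This comparison supplies the
  continuity of \<open>N\<close> needed for infinite sums.\<close>

lemma N_le_norm: obtains C where "C \<ge> 0" "\<And>A. N A \<le> C * norm A"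
proof -
  define E :: "'n \<Rightarrow> 'n \<Rightarrow> complex^'n^'n"
    where "E i j = (\<chi> k l. if k = i \<and> l = j then 1 else 0)" for i j
  define C where "C = (\<Sum>i\<in>UNIV. \<Sum>j\<in>UNIV. N (E i j))"
  have "N A \<le> C * norm A" for A
  proof -
    have "(\<Sum>i\<in>UNIV. \<Sum>j\<in>UNIV. map_matrix ((*) (A $ i $ j)) (E i j)) $ k $ l = A $ k $ l" for k l
    proof -
      have "(\<Sum>i\<in>UNIV. \<Sum>j\<in>UNIV. map_matrix ((*) (A $ i $ j)) (E i j)) $ k $ l
          = (\<Sum>i\<in>UNIV. if i = k then \<Sum>j\<in>UNIV. if j = l then A $ i $ j else 0 else 0)"
        unfolding sum_component by (intro sum.cong refl) (auto simp: E_def map_matrix_def if_distrib[of "(*) _"] cong: if_cong)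
      then show ?thesis by simp
    qed
    then have "A = (\<Sum>i\<in>UNIV. \<Sum>j\<in>UNIV. map_matrix ((*) (A $ i $ j)) (E i j))"
      by (simp add: vec_eq_iff)
    then have "N A = N (\<Sum>i\<in>UNIV. \<Sum>j\<in>UNIV. map_matrix ((*) (A $ i $ j)) (E i j))"
      by (rule arg_cong)
    also have "\<dots> \<le> (\<Sum>i\<in>UNIV. \<Sum>j\<in>UNIV. cmod (A $ i $ j) * N (E i j))"
      by (rule order_trans[OF N_sum], rule sum_mono, rule order_trans[OF N_sum]) (simp add: N_scale)
    also have "\<dots> \<le> (\<Sum>i\<in>UNIV. \<Sum>j\<in>UNIV. norm A * N (E i j))"
    proof (intro sum_mono mult_right_mono N_nonneg)
      show "cmod (A $ i $ j) \<le> norm A" for i j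
        using Finite_Cartesian_Product.norm_nth_le[of "A $ i" j]
          Finite_Cartesian_Product.norm_nth_le[of A i] by linarith
    qed
    also have "\<dots> = C * norm A" by (simp add: C_def sum_distrib_left mult.commute)
    finally show ?thesis .
  qed
  moreover have "C \<ge> 0" unfolding C_def by (intro sum_nonneg N_nonneg)
  ultimately show ?thesis using that by blast
qed

text \<open>By the triangle inequality \<open>N Z\<close> is at most \<open>B\<close> plus
  \<open>C\<close> times the norm of the remainder of a finite partial sum, which tends to
  0.\<close>

lemma N_has_sum_le:
  assumes T: "(T has_sum Z) UNIV" and B: "\<And>F. finite F \<Longrightarrow> N (sum T F) \<le> B"
  shows "N Z \<le> B"
proof -
  obtain C where C: "C \<ge> 0" "\<And>A. N A \<le> C * norm A" using N_le_norm by blast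
  have "((\<lambda>F. B + C * norm (Z - sum T F)) \<longlongrightarrow> B + C * norm (Z - Z)) (finite_subsets_at_top UNIV)"
    using T unfolding has_sum_def by (intro tendsto_intros)
  moreover have "eventually (\<lambda>F. N Z \<le> B + C * norm (Z - sum T F)) (finite_subsets_at_top UNIV)"
  proof (rule eventually_finite_subsets_at_top_weakI)
    fix F :: "'a set" assume "finite F"
    then show "N Z \<le> B + C * norm (Z - sum T F)"
      using N_triangle[of "sum T F" "Z - sum T F"] B[of F] C(2)[of "Z - sum T F"] by simp
  qed
  ultimately have "N Z \<le> B + C * norm (Z - Z)"
    by (rule tendsto_lowerbound) simp
  then show ?thesis by simp
qed

text \<open>Conjugating \<open>Y\<close> by the diagonal unitary \<open>U m\<close> multiplies entry
  \<open>(i, j)\<close> by \<open>cis (of_int m * (b i - b j))\<close>. The entrywise product is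
  therefore a sum of scaled unitary conjugates of \<open>Y\<close>, each of norm
  \<open>cmod (a m) * N Y\<close>.\<close>

lemma N_schur_multiplier_le:
  fixes a :: "int \<Rightarrow> complex" and b :: "'n \<Rightarrow> real"
  assumes a: "(\<lambda>m. cmod (a m)) summable_on UNIV"
    and f: "\<And>i j. (\<Sum>\<^sub>\<infinity>m\<in>UNIV. (- 1) powi m * a m * cis (of_int m * (b i - b j))) = f i j"
  shows "N (\<chi> i j. f i j * Y $ i $ j) \<le> (\<Sum>\<^sub>\<infinity>m\<in>UNIV. cmod (a m)) * N Y"
proof -
  define c where "c m = (- 1) powi m * a m" for m
  have c: "cmod (c m) = cmod (a m)" for m by (simp add: c_def norm_mult norm_power_int)
  define U where "U m = diag (\<lambda>i. cis (of_int m * b i))" for m :: int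
  have U: "unitary_matrix (U m)" for m by (simp add: U_def unitary_matrix_diag)
  define T where "T m = map_matrix ((*) (c m)) (U m ** Y ** conj_transpose (U m))" for m
  have T_nth: "T m $ i $ j = c m * cis (of_int m * (b i - b j)) * Y $ i $ j" for m i j
    by (simp add: T_def U_def conj_transpose_diag map_matrix_def cis_cnj cis_mult algebra_simps
        flip: cis_divide)
  have NT: "N (T m) = cmod (a m) * N Y" for m
    by (simp add: T_def N_scale c N_unitary_left N_unitary_right U unitary_matrix_conj_transpose)
  have entry: "((\<lambda>m. T m $ i $ j) has_sum f i j * Y $ i $ j) UNIV" for i j
  proof -
    have "(\<lambda>m. c m * cis (of_int m * (b i - b j))) summable_on UNIV"
      by (rule abs_summable_summable) (simp add: norm_mult c a)
    then have "((\<lambda>m. c m * cis (of_int m * (b i - b j))) has_sum f i j) UNIV"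
      unfolding f[symmetric] c_def by (rule has_sum_infsum)
    then show ?thesis unfolding T_nth by (rule has_sum_cmult_left)
  qed
  have "(T has_sum (\<chi> i j. f i j * Y $ i $ j)) UNIV"
    unfolding has_sum_def
    by (intro vec_tendstoI) (use entry in \<open>simp add: has_sum_def\<close>)
  then show ?thesis
  proof (rule N_has_sum_le)
    fix F :: "int set" assume F: "finite F"
    have "N (sum T F) \<le> (\<Sum>m\<in>F. cmod (a m)) * N Y"
      using N_sum[of T F] by (simp add: NT sum_distrib_right)
    also have "\<dots> \<le> (\<Sum>\<^sub>\<infinity>m\<in>UNIV. cmod (a m)) * N Y"
      by (intro mult_right_mono finite_sum_le_infsum a F N_nonneg) auto
    finally show "N (sum T F) \<le> (\<Sum>\<^sub>\<infinity>m\<in>UNIV. cmod (a m)) * N Y" .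
  qed
qed

text \<open>Both \<open>S\<close> and its transpose are unitarily equivalent to the same diagonal
  matrix.\<close>

lemma N_transpose_skew_hermitian:
  assumes "skew_hermitian S"
  shows "N (transpose S) = N S"
proof -
  obtain V d where V: "unitary_matrix V" and S: "S = V ** diag d ** conj_transpose V"
    using skew_hermitian_diagonalization[OF assms] by metis
  have "transpose S = transpose (conj_transpose V) ** diag d ** transpose V"
    by (simp add: S matrix_transpose_mul transpose_diag matrix_mul_assoc)
  then have "N (transpose S) = N (diag d)"
    using V by (simp add: N_unitary_left N_unitary_right unitary_matrix_transpose
        unitary_matrix_conj_transpose)
  also have "\<dots> = N S"
    using V by (simp add: S N_unitary_left N_unitary_right unitary_matrix_conj_transpose)
  finally show ?thesis .
qed

text \<open>The factor 2 counts the two Schur products \<open>A\<^sub>1\<close> and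
  \<open>A\<^sub>2\<close>: up to unitary factors, each derivative is a sum or difference of them,
  and each costs one sum of the moduli of the coefficients.\<close>

lemma Phi_derivative_le:
  fixes \<theta> :: "'n \<Rightarrow> real" and a :: "int \<Rightarrow> complex"
  assumes W: "W \<in> UU" and S: "skew_hermitian S"
    and D\<^sub>1: "(Phi1 has_derivative D\<^sub>1) (at W within UU)"
    and D\<^sub>2: "(Phi2 has_derivative D\<^sub>2) (at W within UU)"
    and spec: "spectrum (Phi2 W) = range (\<lambda>j. cis (\<theta> j))"
    and a: "(\<lambda>m. cmod (a m)) summable_on UNIV"
    and f: "\<And>i j. (\<Sum>\<^sub>\<infinity>m\<in>UNIV. (- 1) powi m * a m * cis (of_int m * (\<theta> i - \<theta> j)))
              = 1 / (1 + cis (\<theta> i - \<theta> j))"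
  shows "N (D\<^sub>1 (W ** S)) \<le> 2 * (\<Sum>\<^sub>\<infinity>m\<in>UNIV. cmod (a m)) * N (W ** S)"
    and "N (D\<^sub>2 (W ** S)) \<le> 2 * (\<Sum>\<^sub>\<infinity>m\<in>UNIV. cmod (a m)) * N (W ** S)"
proof -
  define W\<^sub>1 W\<^sub>2 where "W\<^sub>1 = Phi1 W" and "W\<^sub>2 = Phi2 W"
  define L where "L = D\<^sub>2 (W ** S)"
  \<comment> \<open>Removing \<open>W\<^sub>1\<close> leaves the norm unchanged and yields an
    equation whose only coefficient is \<open>W\<^sub>2\<close>.\<close>
  define K where "K = conj_transpose W\<^sub>1 ** D\<^sub>1 (W ** S)"
  define B where "B = (\<Sum>\<^sub>\<infinity>m\<in>UNIV. cmod (a m))"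
  have W1: "unitary_matrix W\<^sub>1" using Phi1_in[OF W] by (simp add: W\<^sub>1_def real_orthogonal_iff)
  have W12: "W = W\<^sub>1 ** W\<^sub>2" using Phi1_mult_Phi2[OF W] by (simp add: W\<^sub>1_def W\<^sub>2_def)
  have sq: "transpose W ** W = W\<^sub>2 ** W\<^sub>2" using Phi2_square[OF W] by (simp add: W\<^sub>2_def)
  have "conj_transpose W\<^sub>1 ** (W\<^sub>1 ** L + D\<^sub>1 (W ** S) ** W\<^sub>2) = conj_transpose W\<^sub>1 ** (W ** S)"
    using Phi_derivative_equations(1)[OF W S D\<^sub>1 D\<^sub>2] by (simp add: W\<^sub>1_def W\<^sub>2_def L_def)
  then have eqK: "L + K ** W\<^sub>2 = W\<^sub>2 ** S"
    using W1 by (simp add: matrix_add_mult unitary_matrix_cancel K_def W12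
        flip: matrix_mul_assoc)
  have "W\<^sub>2 ** L + L ** W\<^sub>2 = transpose W ** (W ** S) + transpose (W ** S) ** W"
    using Phi_derivative_equations(2)[OF W S D\<^sub>1 D\<^sub>2] by (simp add: W\<^sub>2_def L_def)
  also have "\<dots> = (transpose W ** W) ** S + transpose S ** (transpose W ** W)"
    by (simp add: matrix_transpose_mul matrix_mul_assoc)
  finally have eqL: "W\<^sub>2 ** L + L ** W\<^sub>2 = W\<^sub>2 ** W\<^sub>2 ** S + transpose S ** W\<^sub>2 ** W\<^sub>2"
    by (simp add: sq matrix_mul_assoc)
  obtain V l where V: "unitary_matrix V" and W2: "W\<^sub>2 = V ** diag l ** conj_transpose V"
    and pos: "\<And>i. 0 < Re (l i)"
    using Usym_plus_diagonalization[OF Phi2_in[OF W]] unfolding W\<^sub>2_def by metis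
  have "\<exists>k. l i = cis (\<theta> k)" for i
    using spec spectrum_diagonalized[OF V, of l] by (auto simp flip: W2 W\<^sub>2_def)
  \<comment> \<open>The diagonalization may list the eigenvalues in another order or with other
    multiplicities than \<theta>. Since the series identity holds for every pair of indices, it
    applies to the selected angles.\<close>
  then obtain k where k: "\<And>i. l i = cis (\<theta> (k i))" by metis
  define b where "b i = \<theta> (k i)" for i
  have l: "unitary_matrix (diag l)" by (simp add: unitary_matrix_diag k)
  define Q where "Q X = conj_transpose V ** X ** V" for X
  have Q_mult: "Q (X ** Y) = Q X ** Q Y" for X Y
    using V by (simp add: Q_def unitary_matrix_cancel flip: matrix_mul_assoc)
  have Q_add: "Q (X + Y) = Q X + Q Y" for X Y by (simp add: Q_def matrix_add_mult)
  have N_Q: "N (Q X) = N X" for X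
    using V by (simp add: Q_def N_unitary_left N_unitary_right unitary_matrix_conj_transpose)
  have Q_W2: "Q W\<^sub>2 = diag l"
    using V by (simp add: Q_def W2 unitary_matrix_cancel flip: matrix_mul_assoc)
  define S\<^sub>1 S\<^sub>2 where "S\<^sub>1 = Q S" and "S\<^sub>2 = Q (transpose S)"
  have eqK': "Q L $ i $ j + Q K $ i $ j * l j = l i * S\<^sub>1 $ i $ j" for i j
    using arg_cong[OF eqK, of "\<lambda>X. Q X $ i $ j"] by (simp add: Q_mult Q_add Q_W2 S\<^sub>1_def)
  have eqL': "l i * Q L $ i $ j + Q L $ i $ j * l j = l i * l i * S\<^sub>1 $ i $ j + S\<^sub>2 $ i $ j * l j * l j"
    for i j
    using arg_cong[OF eqL, of "\<lambda>X. Q X $ i $ j"]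
    by (simp add: Q_mult Q_add Q_W2 S\<^sub>1_def S\<^sub>2_def diag_mult_diag)
  \<comment> \<open>The difference of angles is reversed here compared with
    \<open>A\<^sub>2\<close>, because the multipliers wanted are \<open>l i / (l i + l j)\<close>
    for \<open>S\<^sub>1\<close> and \<open>l j / (l i + l j)\<close> for
    \<open>S\<^sub>2\<close>.\<close>
  define A\<^sub>1 where "A\<^sub>1 = (\<chi> i j. 1 / (1 + cis (b j - b i)) * S\<^sub>1 $ i $ j)"
  define A\<^sub>2 where "A\<^sub>2 = (\<chi> i j. 1 / (1 + cis (b i - b j)) * S\<^sub>2 $ i $ j)"
  have l0: "l i \<noteq> 0" for i using pos[of i] by auto
  have ll: "l i + l j \<noteq> 0" for i j
    using pos[of i] pos[of j] by (metis add_pos_pos less_irrefl plus_complex.sel(1) zero_complex.sel(1))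
  have mult: "1 / (1 + cis (b j - b i)) = l i / (l i + l j)" for i j
    using l0[of i] by (simp add: b_def k field_simps flip: cis_divide)
  have A1: "A\<^sub>1 $ i $ j = l i / (l i + l j) * S\<^sub>1 $ i $ j" for i j
    by (simp only: A\<^sub>1_def vec_lambda_beta mult)
  have A2: "A\<^sub>2 $ i $ j = l j / (l i + l j) * S\<^sub>2 $ i $ j" for i j
    by (simp only: A\<^sub>2_def vec_lambda_beta mult add.commute)
  have L: "Q L $ i $ j = l i * A\<^sub>1 $ i $ j + A\<^sub>2 $ i $ j * l j" for i j
  proof -
    \<comment> \<open>The proposed solution is checked in the entrywise Sylvester equation;
      \<open>l i + l j\<close> can be cancelled because its real part is positive.\<close>
    have "(l i + l j) * (l i * A\<^sub>1 $ i $ j + A\<^sub>2 $ i $ j * l j)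
        = l i * ((l i + l j) * A\<^sub>1 $ i $ j) + (l i + l j) * A\<^sub>2 $ i $ j * l j"
      by (simp add: algebra_simps)
    also have "\<dots> = l i * l i * S\<^sub>1 $ i $ j + S\<^sub>2 $ i $ j * l j * l j"
      using ll[of i j] by (simp add: A1 A2)
    also have "\<dots> = (l i + l j) * Q L $ i $ j"
      using eqL'[of i j] by (simp add: algebra_simps)
    finally show ?thesis using ll[of i j] by simp
  qed
  have K: "Q K $ i $ j = A\<^sub>1 $ i $ j - A\<^sub>2 $ i $ j" for i j
  proof -
    have "l i * S\<^sub>1 $ i $ j = (l i + l j) * A\<^sub>1 $ i $ j" using ll[of i j] by (simp add: A1)
    moreover have "l j * Q K $ i $ j = l i * S\<^sub>1 $ i $ j - (l i * A\<^sub>1 $ i $ j + A\<^sub>2 $ i $ j * l j)"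
      using eqK'[of i j] unfolding L by (simp add: algebra_simps)
    ultimately have "l j * Q K $ i $ j = l j * (A\<^sub>1 $ i $ j - A\<^sub>2 $ i $ j)"
      by (simp add: algebra_simps)
    then show ?thesis using l0[of j] by simp
  qed
  have N_S: "N S\<^sub>1 = N (W ** S)" "N S\<^sub>2 = N (W ** S)"
    using W N_transpose_skew_hermitian[OF S]
    by (simp_all add: S\<^sub>1_def S\<^sub>2_def N_Q UU_def N_unitary_left)
  have "N A\<^sub>1 \<le> B * N S\<^sub>1"
    unfolding A\<^sub>1_def B_def
    \<comment> \<open>Negated angles produce the reversed difference
      \<open>b j - b i\<close>.\<close>
    by (rule N_schur_multiplier_le[OF a, of "\<lambda>i. - b i"]) (simp add: b_def f)
  moreover have "N A\<^sub>2 \<le> B * N S\<^sub>2"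
    unfolding A\<^sub>2_def B_def
    by (rule N_schur_multiplier_le[OF a, of b]) (simp add: b_def f)
  ultimately have A: "N A\<^sub>1 + N A\<^sub>2 \<le> 2 * B * N (W ** S)" by (simp add: N_S)
  have "Q K = A\<^sub>1 - A\<^sub>2" by (simp add: vec_eq_iff K)
  then have "N K \<le> N A\<^sub>1 + N A\<^sub>2" using N_diff_le by (metis N_Q)
  moreover have "N K = N (D\<^sub>1 (W ** S))"
    using W1 by (simp add: K_def N_unitary_left unitary_matrix_conj_transpose)
  ultimately show "N (D\<^sub>1 (W ** S)) \<le> 2 * (\<Sum>\<^sub>\<infinity>m\<in>UNIV. cmod (a m)) * N (W ** S)"
    using A by (simp add: B_def)
  have "Q L = diag l ** A\<^sub>1 + A\<^sub>2 ** diag l" by (simp add: vec_eq_iff L)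
  then have "N L \<le> N A\<^sub>1 + N A\<^sub>2"
    using N_triangle[of "diag l ** A\<^sub>1" "A\<^sub>2 ** diag l"] N_Q[of L]
    by (simp add: N_unitary_left N_unitary_right l)
  then show "N (D\<^sub>2 (W ** S)) \<le> 2 * (\<Sum>\<^sub>\<infinity>m\<in>UNIV. cmod (a m)) * N (W ** S)"
    using A by (simp add: B_def L_def)
qed

lemma tangent_norm_le:
  assumes "\<And>S. skew_hermitian S \<Longrightarrow> N (D (W ** S)) \<le> c * N (W ** S)"
  shows "tangent_norm N W D \<le> ereal c"
  unfolding tangent_norm_def
proof (rule SUP_least)
  fix S assume "S \<in> {S. skew_hermitian S \<and> N (W ** S) = 1}"
  then show "ereal (N (D (W ** S))) \<le> ereal c" using assms[of S] by simp
qed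

end

theorem theorem4p1:
  fixes N :: "complex^'n^'n \<Rightarrow> real"
    and W W\<^sub>1 W\<^sub>2 :: "complex^'n^'n"
    and \<theta> :: "'n \<Rightarrow> real"
    and a :: "int \<Rightarrow> complex"
  assumes "unitarily_invariant_norm N"
    and "unitary_matrix W"
    and "- 1 \<notin> spectrum (transpose W ** W)"
    and "W\<^sub>1 \<in> real_orthogonal" and "W\<^sub>2 \<in> Usym_plus" and "W = W\<^sub>1 ** W\<^sub>2"
    and "spectrum W\<^sub>2 = range (\<lambda>j. cis (\<theta> j))"
    and "(\<lambda>m. cmod (a m)) summable_on UNIV"
    and "\<And>i j. (\<Sum>\<^sub>\<infinity>m\<in>UNIV. (- 1) powi m * a m * cis (of_int m * (\<theta> i - \<theta> j)))
              = 1 / (1 + cis (\<theta> i - \<theta> j))"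
  shows "\<forall>\<Phi>\<^sub>k\<in>{Phi1, Phi2}.
           \<Phi>\<^sub>k differentiable (at W within UU) \<and>
           (\<forall>D. (\<Phi>\<^sub>k has_derivative D) (at W within UU) \<longrightarrow>
                tangent_norm N W D \<le> ereal (2 * (\<Sum>\<^sub>\<infinity>m\<in>UNIV. cmod (a m))))"
proof -
  interpret unitarily_invariant N by unfold_locales (rule assms(1))
  have W: "W \<in> UU" using assms(2,3) by (simp add: UU_def)
  have spec: "spectrum (Phi2 W) = range (\<lambda>j. cis (\<theta> j))"
    using Phi_eqI(2)[OF W assms(4-6)] assms(7) by simp
  \<comment> \<open>The derivative equations couple the two factors, so bounding an arbitrary
    derivative of one factor uses some derivative of the other.\<close>
  obtain D\<^sub>1 where D\<^sub>1: "(Phi1 has_derivative D\<^sub>1) (at W within UU)"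
    using Phi1_differentiable[OF W] by (auto simp: differentiable_def)
  obtain D\<^sub>2 where D\<^sub>2: "(Phi2 has_derivative D\<^sub>2) (at W within UU)"
    using Phi2_differentiable[OF W] by (auto simp: differentiable_def)
  have "tangent_norm N W D \<le> ereal (2 * (\<Sum>\<^sub>\<infinity>m\<in>UNIV. cmod (a m)))"
    if "(Phi1 has_derivative D) (at W within UU)" for D
    by (rule tangent_norm_le) (rule Phi_derivative_le(1)[OF W _ that D\<^sub>2 spec assms(8,9)])
  moreover have "tangent_norm N W D \<le> ereal (2 * (\<Sum>\<^sub>\<infinity>m\<in>UNIV. cmod (a m)))"
    if "(Phi2 has_derivative D) (at W within UU)" for D
    by (rule tangent_norm_le) (rule Phi_derivative_le(2)[OF W _ D\<^sub>1 that spec assms(8,9)])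
  ultimately show ?thesis
    using Phi1_differentiable[OF W] Phi2_differentiable[OF W] by blast
qed

end
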